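(* Let $Q$ be a finite quiver and let $V$ be an indecomposable representation of $Q$ over $\mathbb{F}_1$ with finite nice length. Then $V$ is absolutely indecomposable.
   Context: A quiver $Q=(Q_0,Q_1,s,t)$ has vertex set $Q_0$, arrow set $Q_1$ (both finite), and source/target maps $s,t\colon Q_1\to Q_0$. An $\mathbb{F}_1$-vector space is a finite pointed set $(V,0_V)$. An $\mathbb{F}_1$-linear map $f\colon V\to W$ is a pointed map that is injective on $V\setminus f^{-1}(0_W)$. The direct sum is $V\oplus W=V\sqcup_{0_V\sim 0_W}W$. A representation $V$ of $Q$ over $\mathbb{F}_1$ consists of an $\mathbb{F}_1$-vector space $V_i$ for each $i\in Q_0$ and an $\mathbb{F}_1$-linear map $V_\alpha\colon V_{s(\alpha)}\to V_{t(\alpha)}$ for each $\alpha\in Q_1$. Direct sums are formed vertexwise. $V$ is indecomposable if it is nonzero and not isomorphic to a direct sum of two nonzero representations (equivalently, its coefficient quiver, defined below, is connected). Scalar extension: for a field $K$, $V^K$ is the representation of $Q$ over $K$ where $V^K_i$ is the free $K$-vector space on $V_i\setminus\{0_{V_i}\}$ and the arrows act by the $K$-linear extensions of the maps $V_\alpha$ (with $0_{V_i}$ identified with $0$). An indecomposable $\mathbb{F}_1$-representation $V$ is absolutely indecomposable if $V^K$ is indecomposable for all fields $K$. Coefficient quiver: $\Gamma_V$ has vertex set $(\Gamma_V)_0=\coprod_{i\in Q_0}V_i\setminus\{0_{V_i}\}$ and arrow set $(\Gamma_V)_1=\coprod_{\alpha\in Q_1}\{(v,w)\in((\Gamma_V)_0)^2\mid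 V_\alpha(v)=w\}$, with $s((v,w))=v$, $t((v,w))=w$. The quiver morphism $c_V\colon\Gamma_V\to Q$ is induced by these disjoint unions. Nice length: a grading of $V$ is a map $\partial\colon(\Gamma_V)_0\to\mathbb{Z}$. Let $\underline{\partial}=(\partial_0,\dots,\partial_n)$ be a (possibly empty) sequence of gradings. A grading $\partial_{n+1}$ is $\underline{\partial}$-nice if for each pair of arrows $a,b\in(\Gamma_V)_1$ satisfying $c_V(a)=c_V(b)$, $\partial_i(s(a))=\partial_i(s(b))$ for all $0\le i\le n$, and $\partial_i(t(a))=\partial_i(t(b))$ for all $0\le i\le n$, we have $\partial_{n+1}(s(a))-\partial_{n+1}(t(a))=\partial_{n+1}(s(b))-\partial_{n+1}(t(b))$. (For the empty sequence only the condition $c_V(a)=c_V(b)$ is imposed.) The sequence $(\partial_0,\dots,\partial_n)$ is nice if $\partial_i$ is $(\partial_0,\dots,\partial_{i-1})$-nice for all $0\le i\le n$. $V$ has finite nice length if there is a nice sequence $(\partial_0,\dots,\partial_n)$ that distinguishes vertices, i.e. for each pair of vertices $v\ne w\in(\Gamma_V)_0$ there is $0\le i\le n$ with $\partial_i(v)\ne\partial_i(w)$. *)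

theory Defs
  imports Graph_Theory.Digraph "HOL-Library.Poly_Mapping" "HOL-Library.Product_Plus"
begin

text \<open>
  A finite quiver is a \<^locale>\<open>fin_digraph\<close>, with \<open>tail\<close> for the source and \<open>head\<close> for the
  target map; loops and parallel arrows are allowed.
\<close>

section \<open>Representations over F1\<close>

definition f1_space :: "'x set \<Rightarrow> 'x \<Rightarrow> bool" where
  "f1_space A z \<longleftrightarrow> finite A \<and> z \<in> A"

definition f1_linear :: "'x set \<Rightarrow> 'x \<Rightarrow> 'y set \<Rightarrow> 'y \<Rightarrow> ('x \<Rightarrow> 'y) \<Rightarrow> bool" where
  "f1_linear A z B w f \<longleftrightarrow> f ` A \<subseteq> B \<and> f z = w \<and> inj_on f {x \<in> A. f x \<noteq> w}"

text \<open>
  \<open>pts V i\<close> is the pointed set at the vertex \<open>i\<close> and \<open>base V i\<close> its base point.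
  Values outside the vertices, arrows and pointed sets in question are irrelevant.
\<close>

record ('v, 'a, 'x) f1_rep =
  pts :: "'v \<Rightarrow> 'x set"
  base :: "'v \<Rightarrow> 'x"
  act :: "'a \<Rightarrow> 'x \<Rightarrow> 'x"

definition is_f1_rep :: "('v, 'a) pre_digraph \<Rightarrow> ('v, 'a, 'x) f1_rep \<Rightarrow> bool" where
  "is_f1_rep Q V \<longleftrightarrow>
     (\<forall>i \<in> verts Q. f1_space (pts V i) (base V i)) \<and>
     (\<forall>\<alpha> \<in> arcs Q. f1_linear (pts V (tail Q \<alpha>)) (base V (tail Q \<alpha>))
        (pts V (head Q \<alpha>)) (base V (head Q \<alpha>)) (act V \<alpha>))"

definition f1_nonzero :: "('v, 'a) pre_digraph \<Rightarrow> ('v, 'a, 'x) f1_rep \<Rightarrow> bool" where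
  "f1_nonzero Q V \<longleftrightarrow> (\<exists>i \<in> verts Q. pts V i \<noteq> {base V i})"

definition f1_iso :: "('v, 'a) pre_digraph \<Rightarrow> ('v, 'a, 'x) f1_rep \<Rightarrow> ('v, 'a, 'y) f1_rep \<Rightarrow> bool" where
  "f1_iso Q V W \<longleftrightarrow> (\<exists>\<phi>.
     (\<forall>i \<in> verts Q. f1_linear (pts V i) (base V i) (pts W i) (base W i) (\<phi> i) \<and>
                    bij_betw (\<phi> i) (pts V i) (pts W i)) \<and>
     (\<forall>\<alpha> \<in> arcs Q. \<forall>x \<in> pts V (tail Q \<alpha>).
        \<phi> (head Q \<alpha>) (act V \<alpha> x) = act W \<alpha> (\<phi> (tail Q \<alpha>) x)))"

text \<open>
  In the direct sum the two base points are identified: the common base point is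
  represented by \<open>Inl\<close> of the first one, and \<open>Inr\<close> of the second one is left out.
\<close>

definition f1_sum :: "('v, 'a) pre_digraph \<Rightarrow> ('v, 'a, 'x) f1_rep \<Rightarrow> ('v, 'a, 'y) f1_rep \<Rightarrow>
    ('v, 'a, 'x + 'y) f1_rep" where
  "f1_sum Q V W =
     \<lparr> pts = (\<lambda>i. Inl ` pts V i \<union> Inr ` (pts W i - {base W i})),
       base = (\<lambda>i. Inl (base V i)),
       act = (\<lambda>\<alpha> u. case u of
           Inl x \<Rightarrow> Inl (act V \<alpha> x)
         | Inr y \<Rightarrow> if act W \<alpha> y = base W (head Q \<alpha>) then Inl (base V (head Q \<alpha>))
                   else Inr (act W \<alpha> y)) \<rparr>"

text \<open>
  The summands may be taken on the same type of points as \<open>V\<close>: the summands of any direct sum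
  isomorphic to \<open>V\<close> embed into \<open>V\<close> vertexwise.
\<close>

definition f1_indecomposable :: "('v, 'a) pre_digraph \<Rightarrow> ('v, 'a, 'x) f1_rep \<Rightarrow> bool" where
  "f1_indecomposable Q V \<longleftrightarrow> is_f1_rep Q V \<and> f1_nonzero Q V \<and>
     \<not> (\<exists>(U :: ('v, 'a, 'x) f1_rep) (W :: ('v, 'a, 'x) f1_rep). is_f1_rep Q U \<and> is_f1_rep Q W \<and>
          f1_nonzero Q U \<and> f1_nonzero Q W \<and> f1_iso Q V (f1_sum Q U W))"

section \<open>Representations over a field\<close>

text \<open>
  A \<open>K\<close>-representation has at each vertex a subspace of an ambient \<open>K\<close>-vector space, given by
  a type \<open>'e\<close> with scalar multiplication \<open>sc\<close>; the maps at the arrows are linear on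
  these subspaces.
\<close>

definition lin_on :: "('k::field \<Rightarrow> 'e::ab_group_add \<Rightarrow> 'e) \<Rightarrow> ('k \<Rightarrow> 'f::ab_group_add \<Rightarrow> 'f) \<Rightarrow>
    'e set \<Rightarrow> 'f set \<Rightarrow> ('e \<Rightarrow> 'f) \<Rightarrow> bool" where
  "lin_on sc sc' A B f \<longleftrightarrow> f ` A \<subseteq> B \<and>
     (\<forall>x \<in> A. \<forall>y \<in> A. f (x + y) = f x + f y) \<and> (\<forall>c. \<forall>x \<in> A. f (sc c x) = sc' c (f x))"

record ('v, 'a, 'e) lin_rep =
  vsp :: "'v \<Rightarrow> 'e set"
  lmap :: "'a \<Rightarrow> 'e \<Rightarrow> 'e"

definition is_lin_rep :: "('k::field \<Rightarrow> 'e::ab_group_add \<Rightarrow> 'e) \<Rightarrow> ('v, 'a) pre_digraph \<Rightarrow>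
    ('v, 'a, 'e) lin_rep \<Rightarrow> bool" where
  "is_lin_rep sc Q M \<longleftrightarrow> vector_space sc \<and>
     (\<forall>i \<in> verts Q. module.subspace sc (vsp M i)) \<and>
     (\<forall>\<alpha> \<in> arcs Q. lin_on sc sc (vsp M (tail Q \<alpha>)) (vsp M (head Q \<alpha>)) (lmap M \<alpha>))"

definition lin_nonzero :: "('v, 'a) pre_digraph \<Rightarrow> ('v, 'a, 'e::ab_group_add) lin_rep \<Rightarrow> bool" where
  "lin_nonzero Q M \<longleftrightarrow> (\<exists>i \<in> verts Q. vsp M i \<noteq> {0})"

definition lin_iso :: "('k::field \<Rightarrow> 'e::ab_group_add \<Rightarrow> 'e) \<Rightarrow> ('k \<Rightarrow> 'f::ab_group_add \<Rightarrow> 'f) \<Rightarrow>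
    ('v, 'a) pre_digraph \<Rightarrow> ('v, 'a, 'e) lin_rep \<Rightarrow> ('v, 'a, 'f) lin_rep \<Rightarrow> bool" where
  "lin_iso sc sc' Q M N \<longleftrightarrow> (\<exists>\<phi>.
     (\<forall>i \<in> verts Q. lin_on sc sc' (vsp M i) (vsp N i) (\<phi> i) \<and>
                    bij_betw (\<phi> i) (vsp M i) (vsp N i)) \<and>
     (\<forall>\<alpha> \<in> arcs Q. \<forall>x \<in> vsp M (tail Q \<alpha>).
        \<phi> (head Q \<alpha>) (lmap M \<alpha> x) = lmap N \<alpha> (\<phi> (tail Q \<alpha>) x)))"

definition sc_prod :: "('k \<Rightarrow> 'e \<Rightarrow> 'e) \<Rightarrow> ('k \<Rightarrow> 'f \<Rightarrow> 'f) \<Rightarrow> 'k \<Rightarrow> 'e \<times> 'f \<Rightarrow> 'e \<times> 'f" where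
  "sc_prod sc sc' c = map_prod (sc c) (sc' c)"

definition lin_sum :: "('v, 'a, 'e) lin_rep \<Rightarrow> ('v, 'a, 'f) lin_rep \<Rightarrow> ('v, 'a, 'e \<times> 'f) lin_rep" where
  "lin_sum M N = \<lparr> vsp = (\<lambda>i. vsp M i \<times> vsp N i), lmap = (\<lambda>\<alpha>. map_prod (lmap M \<alpha>) (lmap N \<alpha>)) \<rparr>"

text \<open>
  As over F1, the summands may be taken inside the same ambient space as \<open>M\<close>, since they
  embed into \<open>M\<close> vertexwise.
\<close>

definition lin_indecomposable :: "('k::field \<Rightarrow> 'e::ab_group_add \<Rightarrow> 'e) \<Rightarrow> ('v, 'a) pre_digraph \<Rightarrow>
    ('v, 'a, 'e) lin_rep \<Rightarrow> bool" where
  "lin_indecomposable sc Q M \<longleftrightarrow> is_lin_rep sc Q M \<and> lin_nonzero Q M \<and>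
     \<not> (\<exists>(U :: ('v, 'a, 'e) lin_rep) (W :: ('v, 'a, 'e) lin_rep). is_lin_rep sc Q U \<and> is_lin_rep sc Q W \<and>
          lin_nonzero Q U \<and> lin_nonzero Q W \<and>
          lin_iso sc (sc_prod sc sc) Q M (lin_sum U W))"

section \<open>Scalar extension\<close>

text \<open>
  The free \<open>K\<close>-vector space on \<open>S\<close> is the set of \<open>p :: 'x \<Rightarrow>\<^sub>0 'k\<close> with \<open>keys p \<subseteq> S\<close>;
  \<open>Poly_Mapping.single x 1\<close> is the basis vector \<open>x\<close>.
\<close>

definition free_sc :: "'k::field \<Rightarrow> ('x \<Rightarrow>\<^sub>0 'k) \<Rightarrow> ('x \<Rightarrow>\<^sub>0 'k)" where
  "free_sc c p = Poly_Mapping.map ((*) c) p"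

definition scalar_ext :: "('v, 'a) pre_digraph \<Rightarrow> ('v, 'a, 'x) f1_rep \<Rightarrow>
    ('v, 'a, 'x \<Rightarrow>\<^sub>0 'k::field) lin_rep" where
  "scalar_ext Q V =
     \<lparr> vsp = (\<lambda>i. {p. Poly_Mapping.keys p \<subseteq> pts V i - {base V i}}),
       lmap = (\<lambda>\<alpha> p. \<Sum>x \<in> Poly_Mapping.keys p.
         if act V \<alpha> x = base V (head Q \<alpha>) then 0
         else Poly_Mapping.single (act V \<alpha> x) (Poly_Mapping.lookup p x)) \<rparr>"

text \<open>
  A formula cannot quantify over types, so the field is the type argument \<open>'k\<close>. It is a
  type variable in a theorem about this notion, and so ranges over all fields.
\<close>

definition absolutely_indecomposable :: "'k::field itself \<Rightarrow> ('v, 'a) pre_digraph \<Rightarrow>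
    ('v, 'a, 'x) f1_rep \<Rightarrow> bool" where
  "absolutely_indecomposable (_ :: 'k itself) Q V \<longleftrightarrow> f1_indecomposable Q V \<and>
     lin_indecomposable free_sc Q (scalar_ext Q V :: ('v, 'a, 'x \<Rightarrow>\<^sub>0 'k) lin_rep)"

section \<open>Coefficient quiver and nice length\<close>

text \<open>
  A vertex of the coefficient quiver is a pair \<open>(i, x)\<close> with \<open>x\<close> a nonzero point at \<open>i\<close>; an
  arrow is a triple \<open>(\<alpha>, v, w)\<close>. The morphism to \<open>Q\<close> is \<open>fst\<close> on vertices and on arrows.
\<close>

definition coeff_quiver :: "('v, 'a) pre_digraph \<Rightarrow> ('v, 'a, 'x) f1_rep \<Rightarrow>
    ('v \<times> 'x, 'a \<times> ('v \<times> 'x) \<times> ('v \<times> 'x)) pre_digraph" where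
  "coeff_quiver Q V =
     (let \<Gamma>\<^sub>0 = (SIGMA i : verts Q. pts V i - {base V i}) in
      \<lparr> verts = \<Gamma>\<^sub>0,
        arcs = {(\<alpha>, v, w). \<alpha> \<in> arcs Q \<and> v \<in> \<Gamma>\<^sub>0 \<and> w \<in> \<Gamma>\<^sub>0 \<and>
                 fst v = tail Q \<alpha> \<and> fst w = head Q \<alpha> \<and> act V \<alpha> (snd v) = snd w},
        tail = (\<lambda>(\<alpha>, v, w). v),
        head = (\<lambda>(\<alpha>, v, w). w) \<rparr>)"

text \<open>Only the values of a grading on the vertices of the coefficient quiver matter.\<close>

type_synonym ('v, 'x) grading = "'v \<times> 'x \<Rightarrow> int"

definition nice_grading :: "('v, 'a) pre_digraph \<Rightarrow> ('v, 'a, 'x) f1_rep \<Rightarrow>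
    ('v, 'x) grading list \<Rightarrow> ('v, 'x) grading \<Rightarrow> bool" where
  "nice_grading Q V ds d \<longleftrightarrow>
     (let \<Gamma> = coeff_quiver Q V in
      \<forall>a \<in> arcs \<Gamma>. \<forall>b \<in> arcs \<Gamma>.
        fst a = fst b \<and>
        (\<forall>e \<in> set ds. e (tail \<Gamma> a) = e (tail \<Gamma> b)) \<and>
        (\<forall>e \<in> set ds. e (head \<Gamma> a) = e (head \<Gamma> b)) \<longrightarrow>
        d (tail \<Gamma> a) - d (head \<Gamma> a) = d (tail \<Gamma> b) - d (head \<Gamma> b))"

definition nice_sequence :: "('v, 'a) pre_digraph \<Rightarrow> ('v, 'a, 'x) f1_rep \<Rightarrow>
    ('v, 'x) grading list \<Rightarrow> bool" where
  "nice_sequence Q V ds \<longleftrightarrow> (\<forall>i < length ds. nice_grading Q V (take i ds) (ds ! i))"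

definition finite_nice_length :: "('v, 'a) pre_digraph \<Rightarrow> ('v, 'a, 'x) f1_rep \<Rightarrow> bool" where
  "finite_nice_length Q V \<longleftrightarrow> (\<exists>ds. ds \<noteq> [] \<and> nice_sequence Q V ds \<and>
     (\<forall>v \<in> verts (coeff_quiver Q V). \<forall>w \<in> verts (coeff_quiver Q V).
        v \<noteq> w \<longrightarrow> (\<exists>d \<in> set ds. d v \<noteq> d w)))"

end

theory Submission
  imports Defs
begin

text \<open>
  A decomposition of the scalar extension is the same thing as an idempotent endomorphism, so it has
  to be shown that the endomorphism ring has only the idempotents 0 and 1. Write an endomorphism as
  a matrix indexed by the vertices of the coefficient quiver. Given a nice sequence of gradings,
  consider the chain of subrings \<open>A\<^sub>0 \<supseteq> A\<^sub>1 \<supseteq> \<dots>\<close>, where \<open>A\<^sub>i\<close> consists of the endomorphisms that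
  preserve the first \<open>i\<close> gradings. The proof descends from the bottom of this chain to its top and
  shows that every \<open>A\<^sub>i\<close> is a local ring with nilpotent radical. In such a ring an idempotent is
  either nilpotent, hence 0, or invertible, hence 1.

  At the bottom all gradings are preserved. They distinguish the vertices, so the matrices are
  diagonal; they commute with the arrows and the coefficient quiver is connected, because \<open>V\<close> is
  indecomposable over F1. So only scalar matrices remain (\<open>scalars_only\<close>).

  For the step, the next grading splits a matrix in \<open>A\<^sub>i\<close> into homogeneous components, and niceness
  is what makes these commute with the arrows again (\<open>component_in\<close>). Hence \<open>A\<^sub>i\<close> is a \<open>\<int>\<close>-graded ring
  with \<open>A\<^bsub>i+1\<^esub>\<close> as its part of degree 0, and it has only finitely many nonzero degrees. What
  remains is pure ring theory: such a ring is local with nilpotent radical if its part of degree 0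
  is. Homogeneous elements of nonzero degree are nilpotent, hence products of two of them with opposite
  degrees are non-units and lie in the radical of the degree-zero part
  (\<open>opposite_degrees_mult_in_rad\<close>). So this radical and the parts of nonzero degree together span an
  ideal. It is nilpotent: along a long nonzero word of homogeneous elements the degrees of the prefixes
  stay in a finite set, so some degree recurs often, and the factors between its recurrences form a
  long product in the radical of the degree-zero part (\<open>homogeneous_nilpotent\<close>).
\<close>

section \<open>Local rings with nilpotent radical\<close>

text \<open>
  The unit \<open>u\<close> of \<open>A\<close> may differ from the 1 of the ambient ring. This is what the matrices supported on a
  finite set of indices need: their unit is the identity matrix of that set.
\<close>

locale corner_subring =
  fixes u :: "'r::ring_1" and A :: "'r set"
  assumes unit_in: "u \<in> A"
    and unit_left: "a \<in> A \<Longrightarrow> u * a = a"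
    and unit_right: "a \<in> A \<Longrightarrow> a * u = a"
    and diff_in: "a \<in> A \<Longrightarrow> b \<in> A \<Longrightarrow> a - b \<in> A"
    and mult_in: "a \<in> A \<Longrightarrow> b \<in> A \<Longrightarrow> a * b \<in> A"

locale nilpotent_local = corner_subring u A for u :: "'r::ring_1" and A +
  fixes J :: "'r set"
  assumes rad_sub: "J \<subseteq> A"
    and rad_zero: "0 \<in> J"
    and rad_diff: "x \<in> J \<Longrightarrow> y \<in> J \<Longrightarrow> x - y \<in> J"
    and rad_ideal_left: "a \<in> A \<Longrightarrow> x \<in> J \<Longrightarrow> a * x \<in> J"
    and rad_ideal_right: "x \<in> J \<Longrightarrow> a \<in> A \<Longrightarrow> x * a \<in> J"
    and rad_nilpotent: "\<exists>N. \<forall>xs. set xs \<subseteq> J \<and> length xs = N \<longrightarrow> prod_list xs = 0"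
    and unit_outside_rad: "a \<in> A \<Longrightarrow> a \<notin> J \<Longrightarrow> \<exists>b\<in>A. a * b = u"
begin

text \<open>An idempotent inside the radical is nilpotent; outside, it is invertible and can be cancelled from \<open>e * e = e\<close>.\<close>
lemma idempotent_trivial:
  assumes "e \<in> A" and idem: "e * e = e"
  shows "e = 0 \<or> e = u"
proof (cases "e \<in> J")
  case True
  obtain N where N: "\<And>xs. set xs \<subseteq> J \<Longrightarrow> length xs = N \<Longrightarrow> prod_list xs = 0"
    using rad_nilpotent by blast
  have "e ^ N = 0" using N[of "replicate N e"] True
    by (simp add: set_replicate_conv_if)
  moreover have "e ^ Suc n = e" for n by (induction n) (auto simp: idem)
  ultimately show ?thesis by (cases N) auto
next
  case False
  then obtain b where b: "b \<in> A" "e * b = u" using unit_outside_rad assms by blast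
  have "e = e * (e * b)" using unit_right[OF assms(1)] b(2) by simp
  also have "\<dots> = e * b" using idem by (simp flip: mult.assoc)
  also have "\<dots> = u" by (fact b(2))
  finally show ?thesis ..
qed

end

section \<open>Gradings over a local part of degree zero\<close>

text \<open>
  The bound \<open>D\<close> on the degrees stands for finite dimension: it is what makes homogeneous elements of
  nonzero degree nilpotent.
\<close>

locale bounded_grading = corner_subring u A for u :: "'r::ring_1" and A +
  fixes H :: "int \<Rightarrow> 'r set" and D :: int
  assumes hom_sub: "H d \<subseteq> A"
    and hom_zero: "0 \<in> H d"
    and hom_diff: "x \<in> H d \<Longrightarrow> y \<in> H d \<Longrightarrow> x - y \<in> H d"
    and hom_mult: "x \<in> H d \<Longrightarrow> y \<in> H e \<Longrightarrow> x * y \<in> H (d + e)"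
    and hom_bounded: "x \<in> H d \<Longrightarrow> \<bar>d\<bar> > D \<Longrightarrow> x = 0"
    and hom_decomp: "a \<in> A \<Longrightarrow> \<exists>f. (\<forall>d. f d \<in> H d) \<and> a = (\<Sum>d\<in>{-D..D}. f d)"

locale graded_over_local = bounded_grading u A H D + deg0: nilpotent_local u "H 0" J0
  for u :: "'r::ring_1" and A H D J0
begin

lemma hom_power: "x \<in> H d \<Longrightarrow> x ^ Suc m \<in> H (int (Suc m) * d)"
proof (induction m)
  case (Suc m)
  then have "x * x ^ Suc m \<in> H (d + int (Suc m) * d)" using hom_mult by blast
  then show ?case by (simp add: algebra_simps)
qed simp

lemma hom_nilpotent:
  assumes "x \<in> H d" "d \<noteq> 0"
  obtains m where "x ^ m = 0"
proof -
  let ?m = "Suc (nat D)"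
  have "int ?m * 1 \<le> int ?m * \<bar>d\<bar>"
    using assms(2) by (intro mult_left_mono) auto
  moreover have "int ?m > D" by simp
  moreover have "\<bar>int ?m * d\<bar> = int ?m * \<bar>d\<bar>" by (simp add: abs_mult)
  ultimately have "\<bar>int ?m * d\<bar> > D"
    by (metis less_le_trans mult.right_neutral)
  then have "x ^ ?m = 0" using hom_bounded hom_power assms(1) by blast
  then show thesis using that by blast
qed

text \<open>
  Otherwise \<open>x * y\<close> is a unit in degree 0, so \<open>x\<close> and all its powers have right inverses; but \<open>x\<close>
  is nilpotent, as its powers have larger and larger degrees.
\<close>
lemma opposite_degrees_mult_in_rad:
  assumes x: "x \<in> H d" and y: "y \<in> H (- d)" and "d \<noteq> 0"
  shows "x * y \<in> J0"
proof (rule ccontr)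
  assume n: "x * y \<notin> J0"
  have xy: "x * y \<in> H 0" using hom_mult[OF x y] by simp
  then obtain z where z: "z \<in> H 0" "x * y * z = u" using deg0.unit_outside_rad n by blast
  define w where "w = y * z"
  have w: "w \<in> A" "x * w = u"
    using z y hom_sub mult_in unfolding w_def by (blast, simp add: mult.assoc)
  have "\<exists>t\<in>A. x ^ m * t = u" for m
  proof (induction m)
    case 0
    show ?case using unit_in by auto
  next
    case (Suc m)
    then obtain t where t: "t \<in> A" "x ^ m * t = u" by blast
    have "x ^ Suc m * (w * t) = x ^ m * (x * w * t)"
      by (simp only: power_Suc2 mult.assoc)
    also have "\<dots> = u" using t w unit_left by simp
    finally show ?case using t w mult_in by blast
  qed
  moreover obtain m where "x ^ m = 0" using hom_nilpotent x \<open>d \<noteq> 0\<close> by blast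
  ultimately have "u = 0" by (metis mult_zero_left)
  then have "x * y = 0" using xy deg0.unit_left by force
  then show False using n deg0.rad_zero by simp
qed

text \<open>The homogeneous parts of the radical of \<open>A\<close>: outside degree 0 everything is radical.\<close>
definition hrad :: "int \<Rightarrow> 'r set" where
  "hrad d = (if d = 0 then J0 else H d)"

definition total_rad :: "'r set" where
  "total_rad = {\<Sum>d\<in>{-D..D}. f d | f. \<forall>d. f d \<in> hrad d}"

lemma hrad_sub: "hrad d \<subseteq> H d"
  using deg0.rad_sub by (auto simp: hrad_def)

lemma hrad_zero: "0 \<in> hrad d"
  using hom_zero deg0.rad_zero by (simp add: hrad_def)

lemma hrad_mult_hom:
  assumes "x \<in> hrad d" "y \<in> H e"
  shows "x * y \<in> hrad (d + e)"
proof (cases "d + e = 0")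
  case True
  then have e: "e = - d" by simp
  show ?thesis
    using assms True opposite_degrees_mult_in_rad[of x d y] deg0.rad_ideal_right
    by (cases "d = 0") (auto simp: hrad_def e)
next
  case False
  then have "hrad (d + e) = H (d + e)" by (simp add: hrad_def)
  moreover have "x \<in> H d" "y \<in> H e" using assms hrad_sub by blast+
  ultimately show ?thesis using hom_mult by blast
qed

lemma hom_mult_hrad:
  assumes "x \<in> H d" "y \<in> hrad e"
  shows "x * y \<in> hrad (d + e)"
proof (cases "d + e = 0")
  case True
  then have e: "e = - d" by simp
  show ?thesis
    using assms True opposite_degrees_mult_in_rad[of x d y] deg0.rad_ideal_left
    by (cases "d = 0") (auto simp: hrad_def e)
next
  case False
  then have "hrad (d + e) = H (d + e)" by (simp add: hrad_def)
  moreover have "x \<in> H d" "y \<in> H e" using assms hrad_sub by blast+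
  ultimately show ?thesis using hom_mult by blast
qed

lemma total_rad_diff: "x \<in> total_rad \<Longrightarrow> y \<in> total_rad \<Longrightarrow> x - y \<in> total_rad"
proof -
  assume "x \<in> total_rad" "y \<in> total_rad"
  then obtain f g where f: "\<And>d. f d \<in> hrad d" "x = (\<Sum>d\<in>{-D..D}. f d)"
    and g: "\<And>d. g d \<in> hrad d" "y = (\<Sum>d\<in>{-D..D}. g d)"
    unfolding total_rad_def by blast
  have "f d - g d \<in> hrad d" for d
    using f(1)[of d] g(1)[of d] hom_diff deg0.rad_diff by (auto simp: hrad_def split: if_splits)
  moreover have "x - y = (\<Sum>d\<in>{-D..D}. f d - g d)" using f g by (simp add: sum_subtractf)
  ultimately show ?thesis unfolding total_rad_def by (intro CollectI exI[of _ "\<lambda>d. f d - g d"]) simp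
qed

lemma hrad_sub_total_rad: "hrad d \<subseteq> total_rad"
proof
  fix x assume x: "x \<in> hrad d"
  let ?f = "\<lambda>e. if e = d then x else 0"
  have "x = (\<Sum>e\<in>{-D..D}. ?f e)"
    using subsetD[OF hrad_sub x] hom_bounded[of x d]
    by (cases "d \<in> {-D..D}") (auto simp: abs_if)
  then show "x \<in> total_rad"
    unfolding total_rad_def using x hrad_zero by (intro CollectI exI[of _ ?f]) auto
qed

lemma total_rad_zero: "0 \<in> total_rad"
  using hrad_sub_total_rad hrad_zero by blast

lemma total_rad_add: "x \<in> total_rad \<Longrightarrow> y \<in> total_rad \<Longrightarrow> x + y \<in> total_rad"
  using total_rad_diff[of x "0 - y"] total_rad_diff[of 0 y] total_rad_zero by simp

lemma total_rad_sum: "(\<And>i. i \<in> I \<Longrightarrow> f i \<in> total_rad) \<Longrightarrow> (\<Sum>i\<in>I. f i) \<in> total_rad"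
  by (induction I rule: infinite_finite_induct) (auto simp: total_rad_zero total_rad_add)

lemma total_rad_mult_right: "x \<in> total_rad \<Longrightarrow> a \<in> A \<Longrightarrow> x * a \<in> total_rad"
proof -
  assume "x \<in> total_rad" "a \<in> A"
  then obtain f g where f: "\<And>d. f d \<in> hrad d" "x = (\<Sum>d\<in>{-D..D}. f d)"
    and g: "\<And>d. g d \<in> H d" "a = (\<Sum>d\<in>{-D..D}. g d)"
    unfolding total_rad_def using hom_decomp by blast
  show ?thesis unfolding f g sum_product
    using hrad_mult_hom f g hrad_sub_total_rad by (intro total_rad_sum) blast
qed

lemma total_rad_mult_left: "a \<in> A \<Longrightarrow> x \<in> total_rad \<Longrightarrow> a * x \<in> total_rad"
proof -
  assume "x \<in> total_rad" "a \<in> A"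
  then obtain f g where f: "\<And>d. f d \<in> hrad d" "x = (\<Sum>d\<in>{-D..D}. f d)"
    and g: "\<And>d. g d \<in> H d" "a = (\<Sum>d\<in>{-D..D}. g d)"
    unfolding total_rad_def using hom_decomp by blast
  show ?thesis unfolding f g sum_product
    using hom_mult_hrad f g hrad_sub_total_rad by (intro total_rad_sum) blast
qed

lemma total_rad_sub: "total_rad \<subseteq> A"
proof
  fix x assume "x \<in> total_rad"
  then obtain f where f: "\<And>d. f d \<in> hrad d" "x = (\<Sum>d\<in>{-D..D}. f d)"
    unfolding total_rad_def by blast
  have fA: "f d \<in> A" for d using f(1) hrad_sub hom_sub by blast
  have z: "0 \<in> A" using hom_zero hom_sub by blast
  have add: "a + b \<in> A" if "a \<in> A" "b \<in> A" for a b
    using diff_in[OF that(1) diff_in[OF z that(2)]] by simp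
  have "(\<Sum>d\<in>I. f d) \<in> A" for I
    by (induction I rule: infinite_finite_induct) (auto simp: z fA add)
  then show "x \<in> A" using f by simp
qed

text \<open>Words are given by infinite sequences, so that two positions determine a factor of a word.\<close>
definition segment :: "(nat \<Rightarrow> 'r) \<Rightarrow> nat \<Rightarrow> nat \<Rightarrow> 'r" where
  "segment x i j = prod_list (map x [i..<j])"

lemma segment_append: "i \<le> j \<Longrightarrow> j \<le> k \<Longrightarrow> segment x i j * segment x j k = segment x i k"
  unfolding segment_def
  by (metis le_add_diff_inverse map_append prod_list.append upt_add_eq_append)

lemma segment_in_hrad:
  assumes "\<And>i. x i \<in> hrad (deg i)" and "i < j"
  shows "segment x i j \<in> hrad (\<Sum>k=i..<j. deg k)"
  using \<open>i < j\<close>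
proof (induction j)
  case (Suc j)
  show ?case
  proof (cases "i = j")
    case True
    then show ?thesis using assms(1) by (simp add: segment_def)
  next
    case False
    then have "segment x i j \<in> hrad (\<Sum>k=i..<j. deg k)" using Suc by simp
    moreover have "x j \<in> H (deg j)" using assms(1) hrad_sub by blast
    ultimately have "segment x i j * x j \<in> hrad ((\<Sum>k=i..<j. deg k) + deg j)"
      by (rule hrad_mult_hom)
    then show ?thesis using False Suc.prems by (simp add: segment_def)
  qed
qed simp

text \<open>
  \<open>F\<close> is a set of positions in the word \<open>x\<close> at which the prefixes have equal degree, so the segment
  between any two of them has degree 0. Cutting at these positions, from \<open>i\<close> on, makes a segment of
  \<open>x\<close> a product of \<open>n\<close> elements of \<open>J0\<close>.
\<close>
lemma segment_splits:
  assumes x: "\<And>i. x i \<in> hrad (deg i)"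
    and F: "finite F" "i \<in> F" "n \<le> card {j \<in> F. i < j}"
    and ret: "\<And>j k. j \<in> F \<Longrightarrow> k \<in> F \<Longrightarrow> (\<Sum>l<j. deg l) = (\<Sum>l<k. deg l)"
  shows "\<exists>k\<in>F. i \<le> k \<and> (\<exists>ys. set ys \<subseteq> J0 \<and> length ys = n \<and> segment x i k = prod_list ys)"
  using F(2,3)
proof (induction n arbitrary: i)
  case 0
  then show ?case by (intro bexI[of _ i] conjI exI[of _ "[]"]) (auto simp: segment_def)
next
  case (Suc n)
  let ?L = "{j \<in> F. i < j}"
  define k where "k = Min ?L"
  have "card ?L \<noteq> 0" using Suc.prems by simp
  then have L: "finite ?L" "?L \<noteq> {}" by (auto simp: card_eq_0_iff simp del: Collect_empty_eq)
  then have k: "k \<in> F" "i < k" using Min_in[OF L] unfolding k_def by auto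
  have "j = k \<or> k < j" if "j \<in> ?L" for j
    using Min_le[OF L(1) that] unfolding k_def by linarith
  then have "?L = insert k {j \<in> F. k < j}" using k by auto
  then have "Suc (card {j \<in> F. k < j}) = card ?L" using F(1) by simp
  then have "n \<le> card {j \<in> F. k < j}" using Suc.prems by simp
  then obtain m ys where m: "m \<in> F" "k \<le> m" and ys: "set ys \<subseteq> J0" "length ys = n"
    "segment x k m = prod_list ys"
    using Suc.IH k by blast
  have "(\<Sum>l=i..<k. deg l) = (\<Sum>l<k. deg l) - (\<Sum>l<i. deg l)"
    using k(2) sum_diff_nat_ivl[of 0 i k deg] by (simp add: atLeast0LessThan)
  also have "\<dots> = 0" using ret[OF k(1) Suc.prems(1)] by simp
  finally have "segment x i k \<in> J0"
    using segment_in_hrad[of x deg, OF x k(2)] by (simp add: hrad_def)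
  then show ?case
    using m ys k segment_append[of i k m x]
    by (intro bexI[of _ m] conjI exI[of _ "segment x i k # ys"]) auto
qed

text \<open>
  Pigeonhole: if each degree that can occur, and the degree 0 of the empty prefix, were the degree of at most
  \<open>N\<close> prefixes, a word whose prefixes all have such degrees would have length less than \<open>M\<close>. A word with
  another prefix is 0, as this prefix is.
\<close>
lemma homogeneous_nilpotent:
  "\<exists>M. \<forall>xs. (\<forall>y\<in>set xs. \<exists>d. y \<in> hrad d) \<and> length xs = M \<longrightarrow> prod_list xs = 0"
proof -
  obtain N where N: "\<And>xs. set xs \<subseteq> J0 \<Longrightarrow> length xs = N \<Longrightarrow> prod_list xs = 0"
    using deg0.rad_nilpotent by blast
  define I where "I = insert 0 {-D..D}"
  have fin_I: "finite I" by (simp add: I_def)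
  define M where "M = card I * N"
  have "prod_list xs = 0" if hom: "\<forall>y\<in>set xs. \<exists>d. y \<in> hrad d" and len: "length xs = M" for xs
  proof -
    define x where "x i = (if i < M then xs ! i else 0)" for i
    have "\<exists>d. x i \<in> hrad d" for i using hom len hrad_zero by (auto simp: x_def)
    then obtain deg where deg: "\<And>i. x i \<in> hrad (deg i)" by metis
    define s where "s i = (\<Sum>l<i. deg l)" for i
    have "map x [0..<M] = xs" using len by (intro nth_equalityI) (auto simp: x_def)
    then have xs: "prod_list xs = segment x 0 M" by (simp add: segment_def)
    show ?thesis
    proof (cases "\<forall>i\<le>M. s i \<in> I")
      case False
      then obtain i where i: "i \<le> M" "s i \<notin> I" by blast
      then have "0 < i" by (cases i) (auto simp: s_def I_def)
      then have "segment x 0 i \<in> H (s i)"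
        using subsetD[OF hrad_sub segment_in_hrad[of x deg, OF deg \<open>0 < i\<close>]]
        by (simp add: s_def atLeast0LessThan)
      moreover have "\<bar>s i\<bar> > D" using i(2) by (auto simp: I_def)
      ultimately have "segment x 0 i = 0" using hom_bounded by blast
      then show ?thesis using segment_append[of 0 i M x] i(1) xs by simp
    next
      case True
      have "\<exists>c\<in>I. N < card {i \<in> {..M}. s i = c}"
      proof (rule ccontr)
        assume "\<not> ?thesis"
        then have le: "card {i \<in> {..M}. s i = c} \<le> N" if "c \<in> I" for c
          using that by (metis not_less)
        have "{..M} = (\<Union>c\<in>I. {i \<in> {..M}. s i = c})" using True by auto
        then have "card {..M} = card (\<Union>c\<in>I. {i \<in> {..M}. s i = c})" by (rule arg_cong)
        also have "\<dots> \<le> (\<Sum>c\<in>I. card {i \<in> {..M}. s i = c})" by (rule card_UN_le[OF fin_I])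
        also have "\<dots> \<le> of_nat (card I) * N" by (rule sum_bounded_above) (rule le)
        finally show False by (simp add: M_def)
      qed
      then obtain c where c: "N < card {i \<in> {..M}. s i = c}" by blast
      define F where "F = {i \<in> {..M}. s i = c}"
      have "finite F" "N < card F" using c by (simp_all add: F_def)
      then have F: "finite F" "F \<noteq> {}" "N < card F" by auto
      have F_le: "j \<le> M" and F_s: "s j = c" if "j \<in> F" for j using that by (auto simp: F_def)
      define i where "i = Min F"
      have i: "i \<in> F" unfolding i_def using F by simp
      have "j = i \<or> i < j" if "j \<in> F" for j
        using Min_le[OF F(1) that] unfolding i_def by linarith
      then have "F = insert i {j \<in> F. i < j}" using i by auto
      then have "card F = card (insert i {j \<in> F. i < j})" by (rule arg_cong)
      also have "\<dots> = Suc (card {j \<in> F. i < j})" using F(1) by simp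
      finally have N_le: "N \<le> card {j \<in> F. i < j}" using F(3) by simp
      have "(\<Sum>l<j. deg l) = (\<Sum>l<k. deg l)" if "j \<in> F" "k \<in> F" for j k
        using F_s that unfolding s_def by metis
      from segment_splits[of x deg, OF deg F(1) i N_le this]
      obtain k ys where k: "k \<in> F" "i \<le> k"
        and ys: "set ys \<subseteq> J0" "length ys = N" "segment x i k = prod_list ys"
        by blast
      have "segment x i k = 0" using N ys by simp
      then have "segment x 0 k = 0" using segment_append[of 0 i k x] k(2) by simp
      then show ?thesis using segment_append[of 0 k M x] F_le[OF k(1)] xs by simp
    qed
  qed
  then show ?thesis by blast
qed

text \<open>
  Being zero on all words of length \<open>M\<close> passes from homogeneous elements to their sums, one
  letter at a time: \<open>ys\<close> is the part of the word that is still homogeneous.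
\<close>
lemma total_rad_nilpotent: "\<exists>N. \<forall>xs. set xs \<subseteq> total_rad \<and> length xs = N \<longrightarrow> prod_list xs = 0"
proof -
  obtain M where M: "\<And>xs. \<forall>y\<in>set xs. \<exists>d. y \<in> hrad d \<Longrightarrow> length xs = M \<Longrightarrow> prod_list xs = 0"
    using homogeneous_nilpotent by blast
  have "prod_list (ys @ zs) = 0"
    if "\<forall>y\<in>set ys. \<exists>d. y \<in> hrad d" "set zs \<subseteq> total_rad" "length (ys @ zs) = M" for ys zs
    using that
  proof (induction zs arbitrary: ys)
    case Nil
    then show ?case using M by simp
  next
    case (Cons z zs)
    then obtain f where f: "\<And>d. f d \<in> hrad d" "z = (\<Sum>d\<in>{-D..D}. f d)"
      unfolding total_rad_def by auto
    have "prod_list ys * f d * prod_list zs = 0" for d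
      using Cons.IH[of "ys @ [f d]"] Cons.prems f(1) by (auto simp: mult.assoc)
    then show ?case by (simp add: f(2) sum_distrib_left sum_distrib_right mult.assoc)
  qed
  from this[of "[]"] show ?thesis by auto
qed

text \<open>
  An element outside the radical has an invertible component in degree 0. Multiplied by the inverse of this
  component it becomes \<open>u\<close> minus a nilpotent element, which the geometric series inverts.
\<close>
lemma unit_outside_total_rad:
  assumes "a \<in> A" "a \<notin> total_rad"
  shows "\<exists>b\<in>A. a * b = u"
proof -
  obtain f where f: "\<And>d. f d \<in> H d" "a = (\<Sum>d\<in>{-D..D}. f d)"
    using hom_decomp assms(1) by blast
  define g where "g = f(0 := 0)"
  have g: "g d \<in> hrad d" for d using f hrad_zero deg0.rad_zero by (auto simp: g_def hrad_def)
  define h where "h = (\<Sum>d\<in>{-D..D}. g d)"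
  have h: "h \<in> total_rad" unfolding h_def total_rad_def using g by blast
  have a: "a = f 0 + h"
  proof (cases "0 \<in> {-D..D}")
    case True
    then show ?thesis unfolding f(2) h_def g_def
      by (simp add: sum.remove[of "{-D..D}" 0])
  next
    case False
    then have "f 0 = 0" using hom_bounded[OF f(1)[of 0]] by auto
    then show ?thesis unfolding f(2) h_def g_def by (auto intro!: sum.cong)
  qed
  have "f 0 \<notin> J0"
  proof
    assume "f 0 \<in> J0"
    then have "f 0 \<in> total_rad" using hrad_sub_total_rad[of 0] by (auto simp: hrad_def)
    then show False using a h total_rad_add assms(2) by blast
  qed
  then obtain b where b: "b \<in> H 0" "f 0 * b = u" using deg0.unit_outside_rad f(1) by blast
  have bA: "b \<in> A" using b hom_sub by blast
  define n where "n = - (h * b)"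
  have n: "n \<in> total_rad"
    using total_rad_diff[OF total_rad_zero total_rad_mult_right[OF h bA]] by (simp add: n_def)
  have nA: "n \<in> A" using n total_rad_sub by blast
  have ab: "a * b = u - n" by (simp add: a n_def distrib_right b)
  obtain N where N: "\<And>xs. set xs \<subseteq> total_rad \<Longrightarrow> length xs = N \<Longrightarrow> prod_list xs = 0"
    using total_rad_nilpotent by blast
  have nN: "n ^ N = 0" using N[of "replicate N n"] n
    by (simp add: set_replicate_conv_if)
  have "\<exists>q\<in>A. (u - n) * q = u - n ^ k * u" for k
  proof (induction k)
    case 0
    show ?case using diff_in[OF unit_in unit_in] by (intro bexI[of _ 0]) auto
  next
    case (Suc k)
    then obtain q where q: "q \<in> A" "(u - n) * q = u - n ^ k * u" by blast
    have nk: "n ^ k * u \<in> A" for k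
      by (induction k) (auto simp: unit_in mult.assoc nA mult_in)
    have "(u - n) * (q + n ^ k * u) = u - n ^ Suc k * u"
      using unit_left[OF nk] by (simp add: distrib_left q(2)) (simp add: algebra_simps)
    moreover have "q + n ^ k * u \<in> A"
      using diff_in[OF q(1) diff_in[OF diff_in[OF unit_in unit_in] nk]] by simp
    ultimately show ?case by blast
  qed
  from this[of N] obtain q where "q \<in> A" "(u - n) * q = u" using nN by auto
  then show ?thesis using ab bA mult_in by (intro bexI[of _ "b * q"]) (auto simp flip: mult.assoc)
qed

theorem nilpotent_local_total_rad: "nilpotent_local u A total_rad"
  using total_rad_sub total_rad_zero total_rad_diff total_rad_mult_left total_rad_mult_right total_rad_nilpotent unit_outside_total_rad
  by unfold_locales auto

end

section \<open>Row-finite matrices\<close>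

text \<open>
  The endomorphisms of the free module on \<open>'g\<close>, written as matrices that act on row vectors: row \<open>v\<close> is the
  image of the basis vector \<open>v\<close>. Finiteness of the rows makes the product well defined for an
  infinite index type, so that there is a ring of matrices for every type of vertices.
\<close>

typedef (overloaded) ('g, 'k::zero) row_finite_matrix =
    "{m :: 'g \<Rightarrow> 'g \<Rightarrow> 'k. \<forall>v. finite {w. m v w \<noteq> 0}}"
  morphisms entry Matrix
  by (intro exI[of _ "\<lambda>_ _. 0"]) simp

setup_lifting type_definition_row_finite_matrix

lemma finite_row: "finite {w. entry a v w \<noteq> 0}"
  using entry[of a] by simp

lemma matrix_eqI: "(\<And>v w. entry a v w = entry b v w) \<Longrightarrow> a = b"
  by transfer auto

lemma entry_Matrix: "(\<And>v. finite {w. m v w \<noteq> 0}) \<Longrightarrow> entry (Matrix m) v w = m v w"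
  by (simp add: Matrix_inverse)

instantiation row_finite_matrix :: (type, ring_1) ring_1
begin

lift_definition zero_row_finite_matrix :: "('a, 'b) row_finite_matrix" is "\<lambda>_ _. 0"
  by simp

lift_definition one_row_finite_matrix :: "('a, 'b) row_finite_matrix" is
  "\<lambda>v w. if v = w then 1 else 0"
  by simp

lift_definition plus_row_finite_matrix ::
  "('a, 'b) row_finite_matrix \<Rightarrow> ('a, 'b) row_finite_matrix \<Rightarrow> ('a, 'b) row_finite_matrix"
  is "\<lambda>a b v w. a v w + b v w"
  subgoal for a b v
    by (rule finite_subset[of _ "{w. a v w \<noteq> 0} \<union> {w. b v w \<noteq> 0}"]) auto
  done

lift_definition uminus_row_finite_matrix ::
  "('a, 'b) row_finite_matrix \<Rightarrow> ('a, 'b) row_finite_matrix" is "\<lambda>a v w. - a v w"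
  by simp

lift_definition minus_row_finite_matrix ::
  "('a, 'b) row_finite_matrix \<Rightarrow> ('a, 'b) row_finite_matrix \<Rightarrow> ('a, 'b) row_finite_matrix"
  is "\<lambda>a b v w. a v w - b v w"
  subgoal for a b v
    by (rule finite_subset[of _ "{w. a v w \<noteq> 0} \<union> {w. b v w \<noteq> 0}"]) auto
  done

lift_definition times_row_finite_matrix ::
  "('a, 'b) row_finite_matrix \<Rightarrow> ('a, 'b) row_finite_matrix \<Rightarrow> ('a, 'b) row_finite_matrix"
  is "\<lambda>a b v w. \<Sum>u\<in>{u. a v u \<noteq> 0}. a v u * b u w"
  subgoal premises fin for a b v
  proof -
    have "{w. (\<Sum>u\<in>{u. a v u \<noteq> 0}. a v u * b u w) \<noteq> 0} \<subseteq> (\<Union>u\<in>{u. a v u \<noteq> 0}. {w. b u w \<noteq> 0})"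
      by (auto elim!: sum.not_neutral_contains_not_neutral)
    then show ?thesis using fin by (auto elim: finite_subset)
  qed
  done

lemma entry_mult:
  fixes a b :: "('a, 'b) row_finite_matrix"
  assumes "finite F" "{u. entry a v u \<noteq> 0} \<subseteq> F"
  shows "entry (a * b) v w = (\<Sum>u\<in>F. entry a v u * entry b u w)"
  unfolding times_row_finite_matrix.rep_eq
  using assms by (intro sum.mono_neutral_left) auto

instance
proof
  fix a b c :: "('a, 'b) row_finite_matrix"
  note entry_simps = zero_row_finite_matrix.rep_eq one_row_finite_matrix.rep_eq
    plus_row_finite_matrix.rep_eq uminus_row_finite_matrix.rep_eq minus_row_finite_matrix.rep_eq
  show "a + b + c = a + (b + c)" "a + b = b + a" "0 + a = a" "- a + a = 0" "a - b = a + - b"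
    by (rule matrix_eqI; simp add: entry_simps algebra_simps)+
  show "(0 :: ('a, 'b) row_finite_matrix) \<noteq> 1"
  proof
    assume "(0 :: ('a, 'b) row_finite_matrix) = 1"
    then have "entry (0 :: ('a, 'b) row_finite_matrix) undefined undefined = entry 1 undefined undefined"
      by simp
    then show False by (simp add: entry_simps)
  qed
  show "a * b * c = a * (b * c)"
  proof (rule matrix_eqI)
    fix v w
    define F where "F = {u. entry a v u \<noteq> 0}"
    define F' where "F' = (\<Union>u\<in>F. {t. entry b u t \<noteq> 0})"
    have fin: "finite F" "finite F'" unfolding F_def F'_def by (auto simp: finite_row)
    have ab: "entry (a * b) v t = (\<Sum>u\<in>F. entry a v u * entry b u t)" for t
      using entry_mult[OF fin(1)] by (simp add: F_def)
    have "entry (a * b) v t = 0" if "t \<notin> F'" for t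
      unfolding ab using that by (intro sum.neutral) (auto simp: F'_def)
    then have "{t. entry (a * b) v t \<noteq> 0} \<subseteq> F'" by blast
    then have "entry (a * b * c) v w = (\<Sum>t\<in>F'. \<Sum>u\<in>F. entry a v u * entry b u t * entry c t w)"
      using entry_mult[OF fin(2), of "a * b"] by (simp add: ab sum_distrib_right)
    also have "\<dots> = (\<Sum>u\<in>F. \<Sum>t\<in>F'. entry a v u * entry b u t * entry c t w)"
      by (rule sum.swap)
    also have "\<dots> = (\<Sum>u\<in>F. entry a v u * entry (b * c) u w)"
    proof (rule sum.cong[OF refl])
      fix u assume "u \<in> F"
      then have "{t. entry b u t \<noteq> 0} \<subseteq> F'" by (auto simp: F'_def)
      then show "(\<Sum>t\<in>F'. entry a v u * entry b u t * entry c t w) = entry a v u * entry (b * c) u w"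
        using entry_mult[OF fin(2), of b u] by (simp add: sum_distrib_left mult.assoc)
    qed
    also have "\<dots> = entry (a * (b * c)) v w"
      using entry_mult[OF fin(1), of a v] by (simp add: F_def)
    finally show "entry (a * b * c) v w = entry (a * (b * c)) v w" .
  qed
  show "1 * a = a"
    by (rule matrix_eqI) (subst entry_mult[of "{v}" for v], auto simp: entry_simps split: if_splits)
  show "a * 1 = a"
    by (rule matrix_eqI)
      (auto simp: entry_mult[OF finite_row subset_refl] entry_simps finite_row if_distrib[of "(*) _"]
        cong: if_cong)
  show "(a + b) * c = a * c + b * c"
  proof (rule matrix_eqI)
    fix v w
    define F where "F = {u. entry a v u \<noteq> 0} \<union> {u. entry b v u \<noteq> 0}"
    have "finite F" "{u. entry (a + b) v u \<noteq> 0} \<subseteq> F" "{u. entry a v u \<noteq> 0} \<subseteq> F" "{u. entry b v u \<noteq> 0} \<subseteq> F"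
      by (auto simp: F_def finite_row entry_simps)
    then show "entry ((a + b) * c) v w = entry (a * c + b * c) v w"
      by (simp add: entry_mult entry_simps distrib_right sum.distrib)
  qed
  show "a * (b + c) = a * b + a * c"
    by (rule matrix_eqI)
      (simp add: entry_mult[OF finite_row subset_refl] entry_simps distrib_left sum.distrib)
qed

end

lemmas entry_simps = zero_row_finite_matrix.rep_eq one_row_finite_matrix.rep_eq
  plus_row_finite_matrix.rep_eq uminus_row_finite_matrix.rep_eq minus_row_finite_matrix.rep_eq

lemma entry_sum: "entry (\<Sum>i\<in>I. f i) v w = (\<Sum>i\<in>I. entry (f i) v w)"
  by (induction I rule: infinite_finite_induct) (auto simp: entry_simps)

section \<open>Endomorphisms of a quiver with labelled arrows\<close>

text \<open>
  An abstract coefficient quiver: \<open>G\<close> is its set of vertices, and the label \<open>l\<close> of an arrow \<open>(l, v, w)\<close> in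
  \<open>R\<close> plays the role of the arrow of \<open>Q\<close> below it.
\<close>
locale labelled_quiver =
  fixes G :: "'g set" and R :: "('l \<times> 'g \<times> 'g) set"
  assumes finite_G: "finite G"
    and arrows_in: "(l, v, w) \<in> R \<Longrightarrow> v \<in> G \<and> w \<in> G"
begin

definition arrow_matrix :: "'l \<Rightarrow> ('g, 'k::field) row_finite_matrix" where
  "arrow_matrix l = Matrix (\<lambda>v w. if (l, v, w) \<in> R then 1 else 0)"

definition scalar_matrix :: "'k \<Rightarrow> ('g, 'k::field) row_finite_matrix" where
  "scalar_matrix c = Matrix (\<lambda>v w. if v = w \<and> v \<in> G then c else 0)"

text \<open>
  The arrows with label \<open>l\<close> act together as one linear map, \<open>arrow_matrix l\<close>; the second condition is
  that \<open>a\<close> is an endomorphism for this action. The first one says that \<open>a\<close> lives on \<open>G\<close> and preserves the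
  gradings \<open>ds\<close>.
\<close>
definition graded_endos :: "('g \<Rightarrow> int) list \<Rightarrow> ('g, 'k::field) row_finite_matrix set" where
  "graded_endos ds = {a.
     (\<forall>v w. entry a v w \<noteq> 0 \<longrightarrow> v \<in> G \<and> w \<in> G \<and> (\<forall>d\<in>set ds. d v = d w)) \<and>
     (\<forall>l. a * arrow_matrix l = arrow_matrix l * a)}"

lemma entry_arrow: "entry (arrow_matrix l) v w = (if (l, v, w) \<in> R then 1 else 0)"
  unfolding arrow_matrix_def
  by (rule entry_Matrix, rule finite_subset[OF _ finite_G]) (auto dest: arrows_in split: if_splits)

lemma entry_scalar: "entry (scalar_matrix c) v w = (if v = w \<and> v \<in> G then c else 0)"
  unfolding scalar_matrix_def
  by (rule entry_Matrix, rule finite_subset[OF _ finite_G]) (auto split: if_splits)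

lemma entry_mult_supported:
  "(\<And>u. entry a v u \<noteq> 0 \<Longrightarrow> u \<in> G) \<Longrightarrow> entry (a * b) v w = (\<Sum>u\<in>G. entry a v u * entry b u w)"
  using finite_G by (intro entry_mult) auto

lemma entry_arrow_mult: "entry (arrow_matrix l * a) v w = (\<Sum>u\<in>G. if (l, v, u) \<in> R then entry a u w else 0)"
  by (subst entry_mult_supported) (auto simp: entry_arrow dest: arrows_in split: if_splits intro!: sum.cong)

lemma entry_scalar_mult: "entry (scalar_matrix c * a) v w = (if v \<in> G then c * entry a v w else 0)"
proof -
  have "entry (scalar_matrix c * a) v w = (\<Sum>u\<in>G. if v = u then c * entry a v w else 0)"
    by (subst entry_mult_supported) (auto simp: entry_scalar split: if_splits intro!: sum.cong)
  then show ?thesis using finite_G by simp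
qed

lemma entry_mult_scalar:
  assumes "\<And>u. entry a v u \<noteq> 0 \<Longrightarrow> u \<in> G"
  shows "entry (a * scalar_matrix c) v w = entry a v w * c"
proof -
  have "entry (a * scalar_matrix c) v w = (\<Sum>u\<in>G. if u = w then entry a v w * c else 0)"
    using assms by (subst entry_mult_supported) (auto simp: entry_scalar intro!: sum.cong)
  then show ?thesis using finite_G assms by auto
qed

lemma supported: "a \<in> graded_endos ds \<Longrightarrow> entry a v w \<noteq> 0 \<Longrightarrow> v \<in> G \<and> w \<in> G"
  by (auto simp: graded_endos_def)

lemma scalar_in: "scalar_matrix c \<in> graded_endos ds"
proof -
  have "scalar_matrix c * arrow_matrix l = arrow_matrix l * scalar_matrix c" for l
  proof (rule matrix_eqI)
    fix v w
    have "entry (arrow_matrix l * scalar_matrix c) v w = entry (arrow_matrix l) v w * c"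
      by (rule entry_mult_scalar) (auto simp: entry_arrow dest: arrows_in split: if_splits)
    then show "entry (scalar_matrix c * arrow_matrix l) v w = entry (arrow_matrix l * scalar_matrix c) v w"
      by (auto simp: entry_scalar_mult entry_arrow dest: arrows_in)
  qed
  then show ?thesis by (auto simp: graded_endos_def entry_scalar split: if_splits)
qed

lemma mult_entry_nonzero:
  fixes a b :: "('g, 'k::field) row_finite_matrix"
  assumes "entry (a * b) v w \<noteq> 0"
  obtains u where "entry a v u \<noteq> 0" "entry b u w \<noteq> 0"
proof -
  have "(\<Sum>u | entry a v u \<noteq> 0. entry a v u * entry b u w) \<noteq> 0"
    using assms by (simp add: entry_mult[OF finite_row subset_refl])
  then obtain u where "entry a v u * entry b u w \<noteq> 0"
    by (rule sum.not_neutral_contains_not_neutral)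
  then show thesis by (intro that[of u]) auto
qed

lemma corner_subring_graded_endos: "corner_subring (scalar_matrix 1) (graded_endos ds)"
proof
  fix a b :: "('g, 'k::field) row_finite_matrix"
  show "scalar_matrix 1 \<in> graded_endos ds" by (rule scalar_in)
  show "scalar_matrix 1 * a = a" if "a \<in> graded_endos ds"
    using supported[OF that] by (intro matrix_eqI) (auto simp: entry_scalar_mult)
  show "a * scalar_matrix 1 = a" if "a \<in> graded_endos ds"
    using supported[OF that] by (intro matrix_eqI) (simp add: entry_mult_scalar)
  show "a - b \<in> graded_endos ds" if "a \<in> graded_endos ds" "b \<in> graded_endos ds"
  proof -
    have "entry a v w \<noteq> 0 \<or> entry b v w \<noteq> 0" if "entry (a - b) v w \<noteq> 0" for v w
      using that by (auto simp: entry_simps)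
    then have "v \<in> G \<and> w \<in> G \<and> (\<forall>d\<in>set ds. d v = d w)" if "entry (a - b) v w \<noteq> 0" for v w
      using that \<open>a \<in> graded_endos ds\<close> \<open>b \<in> graded_endos ds\<close> unfolding graded_endos_def by blast
    moreover have "(a - b) * arrow_matrix l = arrow_matrix l * (a - b)" for l
      using that by (simp add: graded_endos_def left_diff_distrib right_diff_distrib)
    ultimately show ?thesis unfolding graded_endos_def by blast
  qed
  show "a * b \<in> graded_endos ds" if a: "a \<in> graded_endos ds" and b: "b \<in> graded_endos ds"
  proof -
    have "a * b * arrow_matrix l = arrow_matrix l * (a * b)" for l
      using a b by (simp add: graded_endos_def mult.assoc) (simp flip: mult.assoc)
    moreover have "v \<in> G \<and> w \<in> G \<and> (\<forall>d\<in>set ds. d v = d w)" if nz: "entry (a * b) v w \<noteq> 0" for v w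
    proof -
      obtain u where "entry a v u \<noteq> 0" "entry b u w \<noteq> 0" using mult_entry_nonzero[OF nz] .
      then have "v \<in> G \<and> (\<forall>d\<in>set ds. d v = d u)" "w \<in> G \<and> (\<forall>d\<in>set ds. d u = d w)"
        using a b unfolding graded_endos_def by blast+
      then show ?thesis by metis
    qed
    ultimately show ?thesis unfolding graded_endos_def by blast
  qed
qed

definition nice :: "('g \<Rightarrow> int) list \<Rightarrow> ('g \<Rightarrow> int) \<Rightarrow> bool" where
  "nice ds d \<longleftrightarrow> (\<forall>l v w v' w'. (l, v, w) \<in> R \<longrightarrow> (l, v', w') \<in> R \<longrightarrow>
     (\<forall>e\<in>set ds. e v = e v' \<and> e w = e w') \<longrightarrow> d v - d w = d v' - d w')"

definition component :: "('g \<Rightarrow> int) \<Rightarrow> int \<Rightarrow> ('g, 'k::field) row_finite_matrix \<Rightarrow> ('g, 'k) row_finite_matrix" where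
  "component d k a = Matrix (\<lambda>v w. if d w - d v = k then entry a v w else 0)"

lemma entry_component: "entry (component d k a) v w = (if d w - d v = k then entry a v w else 0)"
  unfolding component_def
  by (rule entry_Matrix, rule finite_subset[OF _ finite_row[of a]]) auto

text \<open>
  Compare the entries at \<open>(v, w)\<close> of the two products with an arrow matrix. The contributing terms
  are indexed by arrows \<open>u \<rightarrow> w\<close> and \<open>v \<rightarrow> u'\<close> with label \<open>l\<close>. As \<open>a\<close> preserves \<open>ds\<close>, any two of these
  arrows agree on \<open>ds\<close> at both ends, so by niceness \<open>d\<close> changes equally along them. Hence all
  contributing entries of \<open>a\<close> have the same degree, and taking components keeps either all or none of the terms.
\<close>
lemma component_in:
  assumes nice: "nice ds d" and a: "a \<in> graded_endos ds"
  shows "component d k a \<in> graded_endos ds"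
proof -
  have "component d k a * arrow_matrix l = arrow_matrix l * component d k a" for l
  proof (rule matrix_eqI)
    fix v w
    \<comment> \<open>The indices \<open>u\<close> that contribute to the product on the left and on the right, respectively.\<close>
    define P where "P u \<longleftrightarrow> (l, u, w) \<in> R \<and> entry a v u \<noteq> 0" for u
    define P' where "P' u \<longleftrightarrow> (l, v, u) \<in> R \<and> entry a u w \<noteq> 0" for u
    have agree: "\<And>v w. entry a v w \<noteq> 0 \<Longrightarrow> \<forall>e\<in>set ds. e v = e w"
      using a by (auto simp: graded_endos_def)
    have nice': "d u - d u' = d t - d t'"
      if "(l, u, u') \<in> R" "(l, t, t') \<in> R" "\<forall>e\<in>set ds. e u = e t" "\<forall>e\<in>set ds. e u' = e t'" for u u' t t'
      using nice that unfolding nice_def by blast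
    have PP: "d u = d u'" if "P u" "P u'" for u u'
    proof -
      have "\<forall>e\<in>set ds. e u = e u'"
        using that agree[of v u] agree[of v u'] unfolding P_def by metis
      then have "d u - d w = d u' - d w"
        using that nice'[of u w u' w] unfolding P_def by blast
      then show ?thesis by simp
    qed
    have P'P': "d u = d u'" if "P' u" "P' u'" for u u'
    proof -
      have "\<forall>e\<in>set ds. e u = e u'"
        using that agree[of u w] agree[of u' w] unfolding P'_def by metis
      then have "d v - d u = d v - d u'"
        using that nice'[of v u v u'] unfolding P'_def by blast
      then show ?thesis by simp
    qed
    have PP': "d u - d w = d v - d u'" if "P u" "P' u'" for u u'
    proof -
      have "\<forall>e\<in>set ds. e u = e v" "\<forall>e\<in>set ds. e w = e u'"
        using that agree[of v u] agree[of u' w] unfolding P_def P'_def by metis+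
      then show ?thesis using that nice'[of u w v u'] unfolding P_def P'_def by blast
    qed
    \<comment> \<open>Whether the common degree of the contributing entries is \<open>k\<close>.\<close>
    define b where "b \<longleftrightarrow> (\<exists>u. P u \<and> d u - d v = k) \<or> (\<exists>u. P' u \<and> d w - d u = k)"
    have bP: "b \<longleftrightarrow> d u - d v = k" if "P u" for u
    proof
      assume b
      then consider u' where "P u'" "d u' - d v = k" | u' where "P' u'" "d w - d u' = k"
        unfolding b_def by blast
      then show "d u - d v = k"
      proof cases
        case 1
        then show ?thesis using PP[OF that 1(1)] by simp
      next
        case 2
        then show ?thesis using PP'[OF that 2(1)] by simp
      qed
    qed (use that b_def in blast)
    have bP': "b \<longleftrightarrow> d w - d u = k" if "P' u" for u
    proof
      assume b
      then consider u' where "P u'" "d u' - d v = k" | u' where "P' u'" "d w - d u' = k"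
        unfolding b_def by blast
      then show "d w - d u = k"
      proof cases
        case 1
        then show ?thesis using PP'[OF 1(1) that] by simp
      next
        case 2
        then show ?thesis using P'P'[OF that 2(1)] by simp
      qed
    qed (use that b_def in blast)
    have "entry (component d k a * arrow_matrix l) v w
        = (\<Sum>u\<in>G. entry (component d k a) v u * entry (arrow_matrix l) u w)"
      using supported[OF a] by (intro entry_mult_supported) (auto simp: entry_component split: if_splits)
    also have "\<dots> = (\<Sum>u\<in>G. if b then entry a v u * entry (arrow_matrix l) u w else 0)"
      using bP unfolding P_def by (intro sum.cong) (auto simp: entry_component entry_arrow)
    also have "\<dots> = (if b then entry (a * arrow_matrix l) v w else 0)"
      using supported[OF a] by (simp add: entry_mult_supported)
    also have "\<dots> = (if b then entry (arrow_matrix l * a) v w else 0)"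
      using a by (simp add: graded_endos_def)
    also have "\<dots> = (\<Sum>u\<in>G. if b then (if (l, v, u) \<in> R then entry a u w else 0) else 0)"
      by (simp add: entry_arrow_mult)
    also have "\<dots> = entry (arrow_matrix l * component d k a) v w"
      unfolding entry_arrow_mult using bP' unfolding P'_def
      by (intro sum.cong) (auto simp: entry_component)
    finally show "entry (component d k a * arrow_matrix l) v w = entry (arrow_matrix l * component d k a) v w" .
  qed
  then show ?thesis using a unfolding graded_endos_def
    by (auto simp: entry_component split: if_splits)
qed

definition homogeneous :: "('g \<Rightarrow> int) list \<Rightarrow> ('g \<Rightarrow> int) \<Rightarrow> int \<Rightarrow> ('g, 'k::field) row_finite_matrix set" where
  "homogeneous ds d k = {a \<in> graded_endos ds. \<forall>v w. entry a v w \<noteq> 0 \<longrightarrow> d w - d v = k}"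

lemma homogeneous_zero: "homogeneous ds d 0 = graded_endos (ds @ [d])"
  unfolding homogeneous_def graded_endos_def by auto

lemma grading_graded_endos:
  assumes nice: "nice ds d"
  shows "bounded_grading (scalar_matrix 1) (graded_endos ds :: ('g, 'k::field) row_finite_matrix set)
    (homogeneous ds d) (2 * (\<Sum>v\<in>G. \<bar>d v\<bar>))"
proof -
  interpret corner_subring "scalar_matrix 1" "graded_endos ds :: ('g, 'k) row_finite_matrix set"
    by (rule corner_subring_graded_endos)
  let ?D = "2 * (\<Sum>v\<in>G. \<bar>d v\<bar>)"
  have bound: "\<bar>d w - d v\<bar> \<le> ?D" if "v \<in> G" "w \<in> G" for v w
    using member_le_sum[of v G "\<lambda>v. \<bar>d v\<bar>"] member_le_sum[of w G "\<lambda>v. \<bar>d v\<bar>"] that finite_G by auto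
  show ?thesis
  proof
    fix k l :: int and x y :: "('g, 'k) row_finite_matrix"
    show "homogeneous ds d k \<subseteq> (graded_endos ds :: ('g, 'k) row_finite_matrix set)"
      by (auto simp: homogeneous_def)
    show "(0 :: ('g, 'k) row_finite_matrix) \<in> homogeneous ds d k"
      using diff_in[OF unit_in unit_in] by (simp add: homogeneous_def entry_simps)
    show "x - y \<in> homogeneous ds d k" if "x \<in> homogeneous ds d k" "y \<in> homogeneous ds d k"
      using that diff_in[of x y] unfolding homogeneous_def
      by (auto simp: entry_simps) (metis diff_self)
    show "x * y \<in> homogeneous ds d (k + l)" if "x \<in> homogeneous ds d k" "y \<in> homogeneous ds d l"
    proof -
      have "d w - d v = k + l" if nz: "entry (x * y) v w \<noteq> 0" for v w
      proof -
        obtain u where "entry x v u \<noteq> 0" "entry y u w \<noteq> 0" using mult_entry_nonzero[OF nz] .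
        then have "d u - d v = k" "d w - d u = l"
          using \<open>x \<in> homogeneous ds d k\<close> \<open>y \<in> homogeneous ds d l\<close>
          unfolding homogeneous_def by blast+
        then show ?thesis by simp
      qed
      then show ?thesis using that mult_in unfolding homogeneous_def by auto
    qed
    show "x = 0" if x: "x \<in> homogeneous ds d k" "\<bar>k\<bar> > ?D"
    proof (rule matrix_eqI)
      fix v w
      have "entry x v w = 0"
      proof (rule ccontr)
        assume nz: "entry x v w \<noteq> 0"
        then have "v \<in> G" "w \<in> G" "d w - d v = k"
          using x(1) supported[of x ds v w] by (auto simp: homogeneous_def)
        then show False using bound[of v w] x(2) by simp
      qed
      then show "entry x v w = entry 0 v w" by (simp add: entry_simps)
    qed
    show "\<exists>f. (\<forall>k. f k \<in> homogeneous ds d k) \<and> x = (\<Sum>k\<in>{-?D..?D}. f k)"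
      if x: "x \<in> graded_endos ds"
    proof (intro exI[of _ "\<lambda>k. component d k x"] conjI allI matrix_eqI)
      show "component d k x \<in> homogeneous ds d k" for k
        using component_in[OF nice x] by (simp add: homogeneous_def entry_component)
      fix v w
      have "entry (\<Sum>k\<in>{-?D..?D}. component d k x) v w
          = (\<Sum>k\<in>{-?D..?D}. if d w - d v = k then entry x v w else 0)"
        by (simp only: entry_sum entry_component)
      also have "\<dots> = entry x v w"
        using bound[of v w] supported[OF x, of v w]
        by (cases "entry x v w = 0") (auto simp: abs_le_iff)
      finally show "entry x v w = entry (\<Sum>k\<in>{-?D..?D}. component d k x) v w" ..
    qed
  qed
qed

text \<open>
  Distinguished vertices leave only diagonal entries, and commuting with an arrow equates the entries at
  its two ends.
\<close>
lemma scalars_only: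
  assumes distinguish: "\<And>v w. v \<in> G \<Longrightarrow> w \<in> G \<Longrightarrow> v \<noteq> w \<Longrightarrow> \<exists>d\<in>set ds. d v \<noteq> d w"
    and connected: "\<And>P. (\<And>l v w. (l, v, w) \<in> R \<Longrightarrow> P v = P w) \<Longrightarrow> (\<forall>v\<in>G. P v) \<or> (\<forall>v\<in>G. \<not> P v)"
    and a: "a \<in> graded_endos ds"
  shows "\<exists>c. a = scalar_matrix c"
proof -
  have diag: "v = w" if "entry a v w \<noteq> 0" for v w
    using that a distinguish[of v w] unfolding graded_endos_def by blast
  have const: "entry a v v = entry a w w" if vw: "(l, v, w) \<in> R" for l v w
  proof -
    have G: "v \<in> G" "w \<in> G" using arrows_in vw by auto
    have "entry a v v = (\<Sum>u\<in>G. if u = v then entry a v v else 0)" using G finite_G by simp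
    also have "\<dots> = (\<Sum>u\<in>G. entry a v u * entry (arrow_matrix l) u w)"
      using vw diag by (intro sum.cong) (auto simp: entry_arrow)
    also have "\<dots> = entry (a * arrow_matrix l) v w"
      using supported[OF a] by (simp add: entry_mult_supported)
    also have "\<dots> = entry (arrow_matrix l * a) v w" using a by (simp add: graded_endos_def)
    also have "\<dots> = (\<Sum>u\<in>G. if u = w then entry a w w else 0)"
      unfolding entry_arrow_mult using vw diag by (intro sum.cong) auto
    also have "\<dots> = entry a w w" using G finite_G by simp
    finally show ?thesis .
  qed
  have "\<exists>c. \<forall>v\<in>G. entry a v v = c"
  proof (cases "G = {}")
    case False
    then obtain v0 where "v0 \<in> G" by blast
    have "(\<forall>v\<in>G. entry a v v = entry a v0 v0) \<or> (\<forall>v\<in>G. entry a v v \<noteq> entry a v0 v0)"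
      by (rule connected) (metis const)
    then show ?thesis using \<open>v0 \<in> G\<close> by blast
  qed simp
  then obtain c where c: "\<And>v. v \<in> G \<Longrightarrow> entry a v v = c" by blast
  have "a = scalar_matrix c"
    using c diag supported[OF a] by (intro matrix_eqI) (auto simp: entry_scalar, metis+)
  then show ?thesis ..
qed

text \<open>
  By downward induction on \<open>i\<close>, the ring for the first \<open>i\<close> gradings is local with nilpotent
  radical: adding a grading passes to the part of degree 0.
\<close>
theorem idempotent_endo_trivial:
  fixes a :: "('g, 'k::field) row_finite_matrix"
  assumes nice: "\<And>i. i < length ds \<Longrightarrow> nice (take i ds) (ds ! i)"
    and distinguish: "\<And>v w. v \<in> G \<Longrightarrow> w \<in> G \<Longrightarrow> v \<noteq> w \<Longrightarrow> \<exists>d\<in>set ds. d v \<noteq> d w"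
    and connected: "\<And>P. (\<And>l v w. (l, v, w) \<in> R \<Longrightarrow> P v = P w) \<Longrightarrow> (\<forall>v\<in>G. P v) \<or> (\<forall>v\<in>G. \<not> P v)"
    and a: "a \<in> graded_endos []" "a * a = a"
  shows "a = 0 \<or> a = scalar_matrix 1"
proof -
  have "\<exists>J. nilpotent_local (scalar_matrix 1) (graded_endos (take i ds) :: ('g, 'k) row_finite_matrix set) J"
    if "i \<le> length ds" for i
    using that
  proof (induction i rule: inc_induct)
    case base
    interpret corner_subring "scalar_matrix 1" "graded_endos ds :: ('g, 'k) row_finite_matrix set"
      by (rule corner_subring_graded_endos)
    have "\<exists>b\<in>graded_endos ds. x * b = scalar_matrix 1"
      if x: "x \<in> graded_endos ds" "x \<noteq> 0" for x :: "('g, 'k) row_finite_matrix"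
    proof -
      obtain c where c: "x = scalar_matrix c" using scalars_only[OF distinguish connected x(1)] by blast
      have "c \<noteq> 0"
      proof
        assume "c = 0"
        then have "x = 0" unfolding c by (intro matrix_eqI) (simp add: entry_scalar entry_simps)
        then show False using x(2) by simp
      qed
      then have "x * scalar_matrix (1 / c) = scalar_matrix 1"
        unfolding c by (intro matrix_eqI) (simp add: entry_scalar_mult entry_scalar)
      then show ?thesis using scalar_in by blast
    qed
    then have "nilpotent_local (scalar_matrix 1) (graded_endos ds :: ('g, 'k) row_finite_matrix set) {0}"
      using diff_in[OF unit_in unit_in]
      by unfold_locales (auto intro!: exI[of _ 1] simp: length_Suc_conv)
    then show ?case by auto
  next
    case (step i)
    then obtain J where "nilpotent_local (scalar_matrix 1)
        (homogeneous (take i ds) (ds ! i) 0 :: ('g, 'k) row_finite_matrix set) J"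
      by (auto simp: take_Suc_conv_app_nth homogeneous_zero)
    then have "graded_over_local (scalar_matrix 1) (graded_endos (take i ds) :: ('g, 'k) row_finite_matrix set)
        (homogeneous (take i ds) (ds ! i)) (2 * (\<Sum>v\<in>G. \<bar>(ds ! i) v\<bar>)) J"
      using grading_graded_endos[OF nice] step by (intro graded_over_local.intro) auto
    then show ?case using graded_over_local.nilpotent_local_total_rad by blast
  qed
  from this[of 0] obtain J where
    "nilpotent_local (scalar_matrix 1) (graded_endos [] :: ('g, 'k) row_finite_matrix set) J" by auto
  then show ?thesis using nilpotent_local.idempotent_trivial a by blast
qed

end

section \<open>Connectedness of the coefficient quiver\<close>

lemma verts_coeff_quiver:
  "v \<in> verts (coeff_quiver Q V) \<longleftrightarrow> fst v \<in> verts Q \<and> snd v \<in> pts V (fst v) - {base V (fst v)}"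
  by (cases v) (auto simp: coeff_quiver_def Let_def)

lemma arcs_coeff_quiver:
  "(\<alpha>, v, w) \<in> arcs (coeff_quiver Q V) \<longleftrightarrow> \<alpha> \<in> arcs Q \<and>
     v \<in> verts (coeff_quiver Q V) \<and> w \<in> verts (coeff_quiver Q V) \<and>
     fst v = tail Q \<alpha> \<and> fst w = head Q \<alpha> \<and> act V \<alpha> (snd v) = snd w"
  by (auto simp: coeff_quiver_def Let_def)

text \<open>
  The points of \<open>V\<close> with property \<open>P\<close>, together with the base points. The arrows act as before, so this is a
  representation only if \<open>P\<close> is preserved along the arrows of the coefficient quiver.
\<close>

definition restrict_rep ::
  "('v, 'a, 'x) f1_rep \<Rightarrow> ('v \<times> 'x \<Rightarrow> bool) \<Rightarrow> ('v, 'a, 'x) f1_rep" where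
  "restrict_rep V P = V\<lparr>pts := \<lambda>i. {x \<in> pts V i. x = base V i \<or> P (i, x)}\<rparr>"

lemma restrict_rep_simps [simp]:
  "pts (restrict_rep V P) i = {x \<in> pts V i. x = base V i \<or> P (i, x)}"
  "base (restrict_rep V P) = base V" "act (restrict_rep V P) = act V"
  by (simp_all add: restrict_rep_def)

lemma is_f1_rep_restrict:
  assumes Q: "wf_digraph Q" and V: "is_f1_rep Q V"
    and closed: "\<And>\<alpha> v w. (\<alpha>, v, w) \<in> arcs (coeff_quiver Q V) \<Longrightarrow> P v \<Longrightarrow> P w"
  shows "is_f1_rep Q (restrict_rep V P)"
  unfolding is_f1_rep_def
proof (intro conjI ballI)
  fix i assume "i \<in> verts Q"
  then show "f1_space (pts (restrict_rep V P) i) (base (restrict_rep V P) i)"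
    using V by (auto simp: is_f1_rep_def f1_space_def)
next
  fix \<alpha> assume \<alpha>: "\<alpha> \<in> arcs Q"
  let ?i = "tail Q \<alpha>" and ?j = "head Q \<alpha>"
  have ij: "?i \<in> verts Q" "?j \<in> verts Q" using \<alpha> Q by (auto simp: wf_digraph_def)
  have lin: "f1_linear (pts V ?i) (base V ?i) (pts V ?j) (base V ?j) (act V \<alpha>)"
    using V \<alpha> by (simp add: is_f1_rep_def)
  have img: "act V \<alpha> x \<in> pts V ?j \<and> (act V \<alpha> x = base V ?j \<or> P (?j, act V \<alpha> x))"
    if x: "x \<in> pts V ?i" "x = base V ?i \<or> P (?i, x)" for x
  proof (cases "act V \<alpha> x = base V ?j")
    case True
    then show ?thesis using lin x by (auto simp: f1_linear_def)
  next
    case False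
    then have "x \<noteq> base V ?i" "act V \<alpha> x \<in> pts V ?j" using lin x by (auto simp: f1_linear_def)
    then have "(\<alpha>, (?i, x), (?j, act V \<alpha> x)) \<in> arcs (coeff_quiver Q V)"
      using False x \<alpha> ij by (simp add: arcs_coeff_quiver verts_coeff_quiver)
    then show ?thesis using closed x \<open>x \<noteq> base V ?i\<close> \<open>act V \<alpha> x \<in> pts V ?j\<close> by blast
  qed
  have "inj_on (act V \<alpha>) {x \<in> pts (restrict_rep V P) ?i. act V \<alpha> x \<noteq> base V ?j}"
    by (rule inj_on_subset[of _ "{x \<in> pts V ?i. act V \<alpha> x \<noteq> base V ?j}"])
      (use lin in \<open>auto simp: f1_linear_def\<close>)
  then show "f1_linear (pts (restrict_rep V P) ?i) (base (restrict_rep V P) ?i)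
      (pts (restrict_rep V P) ?j) (base (restrict_rep V P) ?j) (act (restrict_rep V P) \<alpha>)"
    using img lin by (auto simp: f1_linear_def)
qed

lemma f1_iso_restrict_sum:
  assumes Q: "wf_digraph Q" and V: "is_f1_rep Q V"
    and inv: "\<And>\<alpha> v w. (\<alpha>, v, w) \<in> arcs (coeff_quiver Q V) \<Longrightarrow> P v = P w"
  shows "f1_iso Q V (f1_sum Q (restrict_rep V P) (restrict_rep V (\<lambda>v. \<not> P v)))"
proof -
  let ?S = "f1_sum Q (restrict_rep V P) (restrict_rep V (\<lambda>v. \<not> P v))"
  define \<phi> where "\<phi> i x = (if x = base V i \<or> P (i, x) then Inl x else Inr x)" for i x
  have "bij_betw (\<phi> i) (pts V i) (pts ?S i)" if "i \<in> verts Q" for i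
    unfolding bij_betw_def
  proof
    show "inj_on (\<phi> i) (pts V i)" by (auto simp: inj_on_def \<phi>_def split: if_splits)
    show "\<phi> i ` pts V i = pts ?S i"
      by (auto simp: f1_sum_def \<phi>_def image_iff split: if_splits)
  qed
  moreover have "f1_linear (pts V i) (base V i) (pts ?S i) (base ?S i) (\<phi> i)" if i: "i \<in> verts Q" for i
    using calculation[OF i] inj_on_subset[of "\<phi> i" "pts V i"]
    by (auto simp: f1_linear_def bij_betw_def) (simp add: f1_sum_def \<phi>_def)
  moreover have "\<phi> (head Q \<alpha>) (act V \<alpha> x) = act ?S \<alpha> (\<phi> (tail Q \<alpha>) x)"
    if \<alpha>: "\<alpha> \<in> arcs Q" and x: "x \<in> pts V (tail Q \<alpha>)" for \<alpha> x
  proof -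
    let ?i = "tail Q \<alpha>" and ?j = "head Q \<alpha>"
    have ij: "?i \<in> verts Q" "?j \<in> verts Q" using \<alpha> Q by (auto simp: wf_digraph_def)
    have lin: "f1_linear (pts V ?i) (base V ?i) (pts V ?j) (base V ?j) (act V \<alpha>)"
      using V \<alpha> by (simp add: is_f1_rep_def)
    have "P (?i, x) = P (?j, act V \<alpha> x)" "x \<noteq> base V ?i" if "act V \<alpha> x \<noteq> base V ?j"
    proof -
      show "x \<noteq> base V ?i" using lin x that by (auto simp: f1_linear_def)
      then have "(\<alpha>, (?i, x), (?j, act V \<alpha> x)) \<in> arcs (coeff_quiver Q V)"
        using lin x that \<alpha> ij by (auto simp: f1_linear_def arcs_coeff_quiver verts_coeff_quiver)
      then show "P (?i, x) = P (?j, act V \<alpha> x)" by (rule inv)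
    qed
    moreover have "act V \<alpha> (base V ?i) = base V ?j" using lin by (simp add: f1_linear_def)
    ultimately show ?thesis by (auto simp: \<phi>_def f1_sum_def)
  qed
  ultimately show ?thesis unfolding f1_iso_def by blast
qed

text \<open>
  A property that is constant along arrows splits \<open>V\<close> into the subrepresentations on the points with and
  without it, and one of these must vanish.
\<close>
lemma f1_indecomposable_connected:
  assumes Q: "wf_digraph Q" and V: "f1_indecomposable Q V"
    and inv: "\<And>\<alpha> v w. (\<alpha>, v, w) \<in> arcs (coeff_quiver Q V) \<Longrightarrow> P v = P w"
  shows "(\<forall>v\<in>verts (coeff_quiver Q V). P v) \<or> (\<forall>v\<in>verts (coeff_quiver Q V). \<not> P v)"
proof (rule ccontr)
  assume "\<not> ?thesis"
  then obtain v w where v: "v \<in> verts (coeff_quiver Q V)" "P v"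
    and w: "w \<in> verts (coeff_quiver Q V)" "\<not> P w" by blast
  have rep: "is_f1_rep Q V" using V by (simp add: f1_indecomposable_def)
  have reps1: "is_f1_rep Q (restrict_rep V P)"
    by (rule is_f1_rep_restrict[OF Q rep]) (drule inv, simp)
  have reps2: "is_f1_rep Q (restrict_rep V (\<lambda>v. \<not> P v))"
    by (rule is_f1_rep_restrict[OF Q rep]) (drule inv, simp)
  have nonzero: "f1_nonzero Q (restrict_rep V S)" if "v \<in> verts (coeff_quiver Q V)" "S v" for S v
  proof -
    have "fst v \<in> verts Q" "snd v \<in> pts (restrict_rep V S) (fst v)" "snd v \<noteq> base V (fst v)"
      using that by (simp_all add: verts_coeff_quiver)
    then show ?thesis unfolding f1_nonzero_def restrict_rep_simps(2) by blast
  qed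
  have "f1_nonzero Q (restrict_rep V P)" "f1_nonzero Q (restrict_rep V (\<lambda>v. \<not> P v))"
    using nonzero[of v P] nonzero[of w "\<lambda>v. \<not> P v"] v w by simp_all
  moreover have "f1_iso Q V (f1_sum Q (restrict_rep V P) (restrict_rep V (\<lambda>v. \<not> P v)))"
    by (rule f1_iso_restrict_sum[OF Q rep inv])
  ultimately show False using V reps1 reps2 unfolding f1_indecomposable_def by blast
qed

section \<open>Decompositions and idempotent endomorphisms\<close>

lemma lin_on_zero: "lin_on sc sc' A B f \<Longrightarrow> 0 \<in> A \<Longrightarrow> f 0 = 0"
  unfolding lin_on_def by (metis add_cancel_right_right)

lemma lin_on_mem: "lin_on sc sc' A B f \<Longrightarrow> x \<in> A \<Longrightarrow> f x \<in> B"
  and lin_on_add: "lin_on sc sc' A B f \<Longrightarrow> x \<in> A \<Longrightarrow> y \<in> A \<Longrightarrow> f (x + y) = f x + f y"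
  and lin_on_scale: "lin_on sc sc' A B f \<Longrightarrow> x \<in> A \<Longrightarrow> f (sc c x) = sc' c (f x)"
  by (auto simp: lin_on_def)

definition endo_family ::
  "('k::field \<Rightarrow> 'e::ab_group_add \<Rightarrow> 'e) \<Rightarrow> ('v, 'a) pre_digraph \<Rightarrow> ('v, 'a, 'e) lin_rep \<Rightarrow> ('v \<Rightarrow> 'e \<Rightarrow> 'e) \<Rightarrow> bool"
  where
  "endo_family sc Q M e \<longleftrightarrow>
     (\<forall>i\<in>verts Q. lin_on sc sc (vsp M i) (vsp M i) (e i)) \<and>
     (\<forall>\<alpha>\<in>arcs Q. \<forall>x\<in>vsp M (tail Q \<alpha>). e (head Q \<alpha>) (lmap M \<alpha> x) = lmap M \<alpha> (e (tail Q \<alpha>) x))"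

text \<open>
  An isomorphism \<open>\<phi>\<close> from \<open>M\<close> to a direct sum turns the projection to the first summand into
  an idempotent of \<open>M\<close>, and this is neither 0 nor 1 if both summands are nonzero.
\<close>
lemma lin_indecomposableI:
  fixes sc :: "'k::field \<Rightarrow> 'e::ab_group_add \<Rightarrow> 'e" and M :: "('v, 'a, 'e) lin_rep"
  assumes Q: "wf_digraph Q" and M: "is_lin_rep sc Q M" "lin_nonzero Q M"
    and idem_trivial: "\<And>e. endo_family sc Q M e \<Longrightarrow>
      (\<And>i x. i \<in> verts Q \<Longrightarrow> x \<in> vsp M i \<Longrightarrow> e i (e i x) = e i x) \<Longrightarrow>
      (\<forall>i\<in>verts Q. \<forall>x\<in>vsp M i. e i x = 0) \<or> (\<forall>i\<in>verts Q. \<forall>x\<in>vsp M i. e i x = x)"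
  shows "lin_indecomposable sc Q M"
  unfolding lin_indecomposable_def
proof (intro conjI M notI)
  assume "\<exists>U W :: ('v, 'a, 'e) lin_rep. is_lin_rep sc Q U \<and> is_lin_rep sc Q W \<and>
    lin_nonzero Q U \<and> lin_nonzero Q W \<and> lin_iso sc (sc_prod sc sc) Q M (lin_sum U W)"
  then obtain U W :: "('v, 'a, 'e) lin_rep"
    where U: "is_lin_rep sc Q U" "lin_nonzero Q U" and W: "is_lin_rep sc Q W" "lin_nonzero Q W"
      and "lin_iso sc (sc_prod sc sc) Q M (lin_sum U W)" by blast
  then obtain \<phi>
    where \<phi>: "\<And>i. i \<in> verts Q \<Longrightarrow> lin_on sc (sc_prod sc sc) (vsp M i) (vsp U i \<times> vsp W i) (\<phi> i)"
        "\<And>i. i \<in> verts Q \<Longrightarrow> bij_betw (\<phi> i) (vsp M i) (vsp U i \<times> vsp W i)"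
      and comm: "\<And>\<alpha> x. \<alpha> \<in> arcs Q \<Longrightarrow> x \<in> vsp M (tail Q \<alpha>) \<Longrightarrow>
        \<phi> (head Q \<alpha>) (lmap M \<alpha> x) = map_prod (lmap U \<alpha>) (lmap W \<alpha>) (\<phi> (tail Q \<alpha>) x)"
    unfolding lin_iso_def lin_sum_def lin_rep.simps by blast
  interpret vector_space sc using M by (simp add: is_lin_rep_def)
  have sub: "subspace (vsp M i)" "subspace (vsp U i)" "subspace (vsp W i)" if "i \<in> verts Q" for i
    using M U W that by (auto simp: is_lin_rep_def)
  define e where "e i x = inv_into (vsp M i) (\<phi> i) (fst (\<phi> i x), 0)" for i x
  have onto: "\<exists>x\<in>vsp M i. \<phi> i x = (a, b)" if "i \<in> verts Q" "a \<in> vsp U i" "b \<in> vsp W i" for i a b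
  proof -
    have "(a, b) \<in> \<phi> i ` vsp M i" using \<phi>(2)[OF that(1)] that by (simp add: bij_betw_def)
    then show ?thesis by (metis imageE)
  qed
  have inj: "x = y" if "i \<in> verts Q" "x \<in> vsp M i" "y \<in> vsp M i" "\<phi> i x = \<phi> i y" for i x y
    using \<phi>(2)[OF that(1)] that by (auto simp: bij_betw_def dest: inj_onD)
  have e: "e i x \<in> vsp M i" "\<phi> i (e i x) = (fst (\<phi> i x), 0)" if "i \<in> verts Q" "x \<in> vsp M i" for i x
  proof -
    have "fst (\<phi> i x) \<in> vsp U i" "0 \<in> vsp W i"
      using lin_on_mem[OF \<phi>(1)] that sub[OF that(1)] subspace_0 by (auto simp: mem_Times_iff)
    then have "(fst (\<phi> i x), 0) \<in> \<phi> i ` vsp M i"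
      using \<phi>(2)[OF that(1)] by (simp add: bij_betw_def)
    then show "e i x \<in> vsp M i" "\<phi> i (e i x) = (fst (\<phi> i x), 0)"
      unfolding e_def by (auto intro: inv_into_into f_inv_into_f)
  qed
  have arrow: "tail Q \<alpha> \<in> verts Q" "head Q \<alpha> \<in> verts Q"
    "lin_on sc sc (vsp M (tail Q \<alpha>)) (vsp M (head Q \<alpha>)) (lmap M \<alpha>)"
    "lin_on sc sc (vsp W (tail Q \<alpha>)) (vsp W (head Q \<alpha>)) (lmap W \<alpha>)" if "\<alpha> \<in> arcs Q" for \<alpha>
    using that Q M W by (auto simp: wf_digraph_def is_lin_rep_def)
  have "endo_family sc Q M e"
    unfolding endo_family_def
  proof (intro conjI ballI)
    fix i assume i: "i \<in> verts Q"
    note mem = subspace_add[OF sub(1)[OF i]] subspace_scale[OF sub(1)[OF i]]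
    show "lin_on sc sc (vsp M i) (vsp M i) (e i)"
      unfolding lin_on_def
    proof (intro conjI ballI allI)
      show "e i ` vsp M i \<subseteq> vsp M i" using e i by blast
      show "e i (x + y) = e i x + e i y" if "x \<in> vsp M i" "y \<in> vsp M i" for x y
        using that by (intro inj[OF i]) (simp_all add: e i mem lin_on_add[OF \<phi>(1)])
      show "e i (sc c x) = sc c (e i x)" if "x \<in> vsp M i" for c x
        using that
        by (intro inj[OF i]) (simp_all add: e i mem lin_on_scale[OF \<phi>(1)] sc_prod_def)
    qed
  next
    fix \<alpha> x assume \<alpha>: "\<alpha> \<in> arcs Q" and x: "x \<in> vsp M (tail Q \<alpha>)"
    note ar = arrow[OF \<alpha>]
    have "lmap W \<alpha> 0 = 0" using lin_on_zero[OF ar(4)] subspace_0[OF sub(3)[OF ar(1)]] by blast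
    then show "e (head Q \<alpha>) (lmap M \<alpha> x) = lmap M \<alpha> (e (tail Q \<alpha>) x)"
      using lin_on_mem[OF ar(3)] ar x
      by (intro inj[OF ar(2)]) (simp_all add: e comm \<alpha>)
  qed
  moreover have "e i (e i x) = e i x" if "i \<in> verts Q" "x \<in> vsp M i" for i x
    using that by (intro inj[of i]) (simp_all add: e)
  ultimately consider (zero) "\<forall>i\<in>verts Q. \<forall>x\<in>vsp M i. e i x = 0" | (one) "\<forall>i\<in>verts Q. \<forall>x\<in>vsp M i. e i x = x"
    using idem_trivial by blast
  then show False
  proof cases
    case zero
    obtain i where i: "i \<in> verts Q" "vsp U i \<noteq> {0}" using U(2) by (auto simp: lin_nonzero_def)
    then obtain a where a: "a \<in> vsp U i" "a \<noteq> 0" using subspace_0[OF sub(2)[OF i(1)]] by blast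
    then obtain x where x: "x \<in> vsp M i" "\<phi> i x = (a, 0)"
      using onto[OF i(1) a(1)] subspace_0[OF sub(3)[OF i(1)]] by blast
    have "\<phi> i 0 = 0" using lin_on_zero[OF \<phi>(1)] i subspace_0[OF sub(1)[OF i(1)]] by blast
    moreover have "\<phi> i (e i x) = (a, 0)" using e(2)[OF i(1) x(1)] x(2) by simp
    ultimately show False using zero i x a(2) by (simp add: zero_prod_def)
  next
    case one
    obtain i where i: "i \<in> verts Q" "vsp W i \<noteq> {0}" using W(2) by (auto simp: lin_nonzero_def)
    then obtain b where b: "b \<in> vsp W i" "b \<noteq> 0" using subspace_0[OF sub(3)[OF i(1)]] by blast
    then obtain x where x: "x \<in> vsp M i" "\<phi> i x = (0, b)"
      using onto[OF i(1) _ b(1)] subspace_0[OF sub(2)[OF i(1)]] by blast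
    have "\<phi> i (e i x) = (0, 0)" using e(2)[OF i(1) x(1)] x(2) by simp
    then show False using one i x b(2) by simp
  qed
qed

section \<open>The scalar extension\<close>

lemma lookup_free_sc [simp]: "Poly_Mapping.lookup (free_sc c p) x = c * Poly_Mapping.lookup p x"
  by (simp add: free_sc_def Poly_Mapping.map.rep_eq when_def)

interpretation free: vector_space "free_sc :: 'k::field \<Rightarrow> ('x \<Rightarrow>\<^sub>0 'k) \<Rightarrow> ('x \<Rightarrow>\<^sub>0 'k)"
  by unfold_locales (rule poly_mapping_eqI, simp add: lookup_add algebra_simps)+

lemma free_subspace: "free.subspace {p :: 'a \<Rightarrow>\<^sub>0 'b::field. Poly_Mapping.keys p \<subseteq> S}"
proof (rule free.subspaceI)
  fix p q :: "'a \<Rightarrow>\<^sub>0 'b" and c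
  assume "p \<in> {p. Poly_Mapping.keys p \<subseteq> S}" "q \<in> {p. Poly_Mapping.keys p \<subseteq> S}"
  then show "p + q \<in> {p. Poly_Mapping.keys p \<subseteq> S}" using Poly_Mapping.keys_add[of p q] by auto
next
  fix p :: "'a \<Rightarrow>\<^sub>0 'b" and c
  assume "p \<in> {p. Poly_Mapping.keys p \<subseteq> S}"
  then show "free_sc c p \<in> {p. Poly_Mapping.keys p \<subseteq> S}"
    by (auto simp: in_keys_iff subset_iff)
qed simp

lemma lin_on_expand:
  fixes f :: "('x \<Rightarrow>\<^sub>0 'k::field) \<Rightarrow> ('y \<Rightarrow>\<^sub>0 'k)"
  assumes f: "lin_on free_sc free_sc {p. Poly_Mapping.keys p \<subseteq> S} B f"
    and "finite S" and p: "Poly_Mapping.keys p \<subseteq> S"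
  shows "Poly_Mapping.lookup (f p) z =
    (\<Sum>x\<in>S. Poly_Mapping.lookup p x * Poly_Mapping.lookup (f (Poly_Mapping.single x 1)) z)"
proof -
  let ?A = "{p :: 'x \<Rightarrow>\<^sub>0 'k. Poly_Mapping.keys p \<subseteq> S}"
  let ?t = "\<lambda>x. free_sc (Poly_Mapping.lookup p x) (Poly_Mapping.single x 1)"
  note sub = free_subspace[of S]
  have single: "Poly_Mapping.single x 1 \<in> ?A" if "x \<in> S" for x using that by simp
  have "(\<Sum>x\<in>T. ?t x) \<in> ?A \<and> f (\<Sum>x\<in>T. ?t x) = (\<Sum>x\<in>T. free_sc (Poly_Mapping.lookup p x) (f (Poly_Mapping.single x 1)))"
    if "T \<subseteq> S" for T
    using finite_subset[OF that \<open>finite S\<close>] that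
  proof (induction T rule: finite_induct)
    case empty
    then show ?case using lin_on_zero[OF f] by simp
  next
    case (insert x T)
    then have t: "?t x \<in> ?A" using free.subspace_scale[OF sub single] by blast
    then show ?case
      using insert free.subspace_add[OF sub t] lin_on_add[OF f t] lin_on_scale[OF f single] by simp
  qed
  then have "f (\<Sum>x\<in>S. ?t x) = (\<Sum>x\<in>S. free_sc (Poly_Mapping.lookup p x) (f (Poly_Mapping.single x 1)))"
    by blast
  moreover have "p = (\<Sum>x\<in>S. ?t x)"
  proof (rule poly_mapping_eqI)
    fix z
    have "Poly_Mapping.lookup p z = 0" if "z \<notin> S" using p that by (auto simp: in_keys_iff)
    moreover have "Poly_Mapping.lookup (\<Sum>x\<in>S. ?t x) z = (\<Sum>x\<in>S. if x = z then Poly_Mapping.lookup p z else 0)"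
      unfolding lookup_sum by (intro sum.cong) (auto simp: lookup_single when_def)
    ultimately show "Poly_Mapping.lookup p z = Poly_Mapping.lookup (\<Sum>x\<in>S. ?t x) z"
      using \<open>finite S\<close> by simp
  qed
  ultimately have "f p = (\<Sum>x\<in>S. free_sc (Poly_Mapping.lookup p x) (f (Poly_Mapping.single x 1)))"
    by simp
  then show ?thesis by (simp add: lookup_sum)
qed

lemma vsp_scalar_ext: "vsp (scalar_ext Q V) i = {p. Poly_Mapping.keys p \<subseteq> pts V i - {base V i}}"
  by (simp add: scalar_ext_def)

lemma lookup_lmap_scalar_ext:
  assumes "finite S" "Poly_Mapping.keys p \<subseteq> S"
  shows "Poly_Mapping.lookup (lmap (scalar_ext Q V) \<alpha> p) z =
    (\<Sum>x\<in>S. if act V \<alpha> x = z \<and> z \<noteq> base V (head Q \<alpha>) then Poly_Mapping.lookup p x else 0)"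
proof -
  have "Poly_Mapping.lookup (lmap (scalar_ext Q V) \<alpha> p) z =
    (\<Sum>x\<in>Poly_Mapping.keys p. if act V \<alpha> x = z \<and> z \<noteq> base V (head Q \<alpha>) then Poly_Mapping.lookup p x else 0)"
    by (auto simp: scalar_ext_def lookup_sum lookup_single when_def intro!: sum.cong)
  also have "\<dots> = (\<Sum>x\<in>S. if act V \<alpha> x = z \<and> z \<noteq> base V (head Q \<alpha>) then Poly_Mapping.lookup p x else 0)"
    using assms by (intro sum.mono_neutral_left) (auto simp: in_keys_iff)
  finally show ?thesis .
qed

lemma lmap_scalar_ext_single:
  "lmap (scalar_ext Q V) \<alpha> (Poly_Mapping.single x (1 :: 'k::field)) =
    (if act V \<alpha> x = base V (head Q \<alpha>) then 0 else Poly_Mapping.single (act V \<alpha> x) 1)"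
  by (simp add: scalar_ext_def)

lemma is_lin_rep_scalar_ext:
  fixes V :: "('v, 'a, 'x) f1_rep"
  assumes Q: "wf_digraph Q" and V: "is_f1_rep Q V"
  shows "is_lin_rep free_sc Q (scalar_ext Q V :: ('v, 'a, 'x \<Rightarrow>\<^sub>0 'k::field) lin_rep)"
  unfolding is_lin_rep_def
proof (intro conjI ballI)
  show "vector_space (free_sc :: 'k \<Rightarrow> ('x \<Rightarrow>\<^sub>0 'k) \<Rightarrow> ('x \<Rightarrow>\<^sub>0 'k))" by unfold_locales
  fix i
  show "free.subspace (vsp (scalar_ext Q V :: ('v, 'a, 'x \<Rightarrow>\<^sub>0 'k) lin_rep) i)"
    unfolding vsp_scalar_ext by (rule free_subspace)
next
  fix \<alpha> assume \<alpha>: "\<alpha> \<in> arcs Q"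
  let ?i = "tail Q \<alpha>" and ?j = "head Q \<alpha>"
  let ?S = "pts V ?i - {base V ?i}"
  have lin: "f1_linear (pts V ?i) (base V ?i) (pts V ?j) (base V ?j) (act V \<alpha>)"
    using V \<alpha> by (simp add: is_f1_rep_def)
  have fin: "finite ?S" using V \<alpha> Q by (auto simp: is_f1_rep_def f1_space_def wf_digraph_def)
  note look = lookup_lmap_scalar_ext[OF fin]
  show "lin_on free_sc free_sc (vsp (scalar_ext Q V :: ('v, 'a, 'x \<Rightarrow>\<^sub>0 'k) lin_rep) ?i) (vsp (scalar_ext Q V) ?j) (lmap (scalar_ext Q V) \<alpha>)"
    unfolding lin_on_def vsp_scalar_ext
  proof (intro conjI ballI allI subsetI)
    fix q :: "'x \<Rightarrow>\<^sub>0 'k" assume "q \<in> lmap (scalar_ext Q V) \<alpha> ` {p. Poly_Mapping.keys p \<subseteq> ?S}"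
    then obtain p where p: "Poly_Mapping.keys p \<subseteq> ?S" "q = lmap (scalar_ext Q V) \<alpha> p" by auto
    have "z \<in> pts V ?j - {base V ?j}" if "Poly_Mapping.lookup q z \<noteq> 0" for z
    proof -
      have "(\<Sum>x\<in>?S. if act V \<alpha> x = z \<and> z \<noteq> base V ?j then Poly_Mapping.lookup p x else 0) \<noteq> 0"
        using that unfolding p(2) look[OF p(1)] .
      then obtain x where "x \<in> ?S"
          "(if act V \<alpha> x = z \<and> z \<noteq> base V ?j then Poly_Mapping.lookup p x else 0) \<noteq> 0"
        by (rule sum.not_neutral_contains_not_neutral)
      then show ?thesis using lin by (auto simp: f1_linear_def split: if_splits)
    qed
    then show "q \<in> {p. Poly_Mapping.keys p \<subseteq> pts V ?j - {base V ?j}}" by (auto simp: in_keys_iff)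
  next
    fix p q :: "'x \<Rightarrow>\<^sub>0 'k"
    assume pq: "p \<in> {p. Poly_Mapping.keys p \<subseteq> ?S}" "q \<in> {p. Poly_Mapping.keys p \<subseteq> ?S}"
    then have keys: "Poly_Mapping.keys p \<subseteq> ?S" "Poly_Mapping.keys q \<subseteq> ?S" by simp_all
    have keys_add: "Poly_Mapping.keys (p + q) \<subseteq> ?S"
      using free.subspace_add[OF free_subspace pq] by (rule CollectD)
    show "lmap (scalar_ext Q V) \<alpha> (p + q) = lmap (scalar_ext Q V) \<alpha> p + lmap (scalar_ext Q V) \<alpha> q"
      by (rule poly_mapping_eqI, unfold lookup_add look[OF keys(1)] look[OF keys(2)] look[OF keys_add]
          sum.distrib[symmetric], rule sum.cong) (simp_all add: lookup_add)
  next
    fix c and p :: "'x \<Rightarrow>\<^sub>0 'k" assume p: "p \<in> {p. Poly_Mapping.keys p \<subseteq> ?S}"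
    then have keys: "Poly_Mapping.keys p \<subseteq> ?S" by simp
    have keys_scale: "Poly_Mapping.keys (free_sc c p) \<subseteq> ?S"
      using free.subspace_scale[OF free_subspace p] by (rule CollectD)
    show "lmap (scalar_ext Q V) \<alpha> (free_sc c p) = free_sc c (lmap (scalar_ext Q V) \<alpha> p)"
      by (rule poly_mapping_eqI, unfold lookup_free_sc look[OF keys] look[OF keys_scale]
          sum_distrib_left, rule sum.cong) simp_all
  qed
qed

lemma lin_nonzero_scalar_ext:
  fixes V :: "('v, 'a, 'x) f1_rep"
  assumes V: "is_f1_rep Q V" "f1_nonzero Q V"
  shows "lin_nonzero Q (scalar_ext Q V :: ('v, 'a, 'x \<Rightarrow>\<^sub>0 'k::field) lin_rep)"
proof -
  obtain i where i: "i \<in> verts Q" "pts V i \<noteq> {base V i}" using V by (auto simp: f1_nonzero_def)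
  moreover have "base V i \<in> pts V i" using V i by (auto simp: is_f1_rep_def f1_space_def)
  ultimately obtain x where "x \<in> pts V i" "x \<noteq> base V i" by blast
  then have "Poly_Mapping.single x (1::'k) \<in> vsp (scalar_ext Q V) i" by (simp add: vsp_scalar_ext)
  moreover have "Poly_Mapping.single x (1::'k) \<noteq> 0" by (simp flip: keys_eq_empty)
  ultimately show ?thesis using i(1) unfolding lin_nonzero_def by blast
qed

section \<open>Endomorphisms of the scalar extension as matrices\<close>

locale coeff_labelled_quiver =
  fixes Q :: "('v, 'a) pre_digraph" and V :: "('v, 'a, 'x) f1_rep"
  assumes fin_Q: "fin_digraph Q" and rep: "is_f1_rep Q V"
begin

abbreviation "\<Gamma> \<equiv> coeff_quiver Q V"

abbreviation nonzero_pts :: "'v \<Rightarrow> 'x set" where "nonzero_pts i \<equiv> pts V i - {base V i}"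

lemma wf_Q: "wf_digraph Q"
  using fin_Q by (simp add: fin_digraph_def)

lemma finite_nonzero_pts: "i \<in> verts Q \<Longrightarrow> finite (nonzero_pts i)"
  using rep by (simp add: is_f1_rep_def f1_space_def)

lemma in_verts: "(i, x) \<in> verts \<Gamma> \<longleftrightarrow> i \<in> verts Q \<and> x \<in> nonzero_pts i"
  by (simp add: verts_coeff_quiver)

sublocale labelled_quiver "verts \<Gamma>" "arcs \<Gamma>"
proof
  have "verts \<Gamma> = (SIGMA i : verts Q. nonzero_pts i)" by (auto simp: in_verts)
  moreover have "finite (verts Q)" using fin_Q by (rule fin_digraph.finite_verts)
  ultimately show "finite (verts \<Gamma>)" using finite_nonzero_pts by simp
qed (simp add: arcs_coeff_quiver)

lemma sum_fibre:
  fixes g :: "'v \<times> 'x \<Rightarrow> 'k::comm_monoid_add"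
  assumes "i \<in> verts Q" "\<And>u. u \<in> verts \<Gamma> \<Longrightarrow> fst u \<noteq> i \<Longrightarrow> g u = 0"
  shows "(\<Sum>u\<in>verts \<Gamma>. g u) = (\<Sum>y\<in>nonzero_pts i. g (i, y))"
proof -
  have "(\<Sum>y\<in>nonzero_pts i. g (i, y)) = sum g (Pair i ` nonzero_pts i)"
    by (subst sum.reindex) (auto simp: inj_on_def)
  also have "\<dots> = (\<Sum>u\<in>verts \<Gamma>. g u)"
  proof (rule sum.mono_neutral_left[OF finite_G])
    show "Pair i ` nonzero_pts i \<subseteq> verts \<Gamma>" using assms(1) by (auto simp: in_verts)
    show "\<forall>u\<in>verts \<Gamma> - Pair i ` nonzero_pts i. g u = 0"
    proof
      fix u assume u: "u \<in> verts \<Gamma> - Pair i ` nonzero_pts i"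
      then have "fst u \<noteq> i" by (cases u) (auto simp: in_verts)
      then show "g u = 0" using assms(2) u by blast
    qed
  qed
  finally show ?thesis ..
qed

text \<open>
  An endomorphism of the scalar extension consists of one map per vertex of \<open>Q\<close>; together they form a
  block diagonal matrix over the coefficient quiver.
\<close>
definition endo_matrix :: "('v \<Rightarrow> ('x \<Rightarrow>\<^sub>0 'k::field) \<Rightarrow> ('x \<Rightarrow>\<^sub>0 'k)) \<Rightarrow> ('v \<times> 'x, 'k) row_finite_matrix" where
  "endo_matrix e = Matrix (\<lambda>v w. if v \<in> verts \<Gamma> \<and> w \<in> verts \<Gamma> \<and> fst v = fst w
     then Poly_Mapping.lookup (e (fst v) (Poly_Mapping.single (snd v) 1)) (snd w) else 0)"

lemma entry_endo_matrix:
  "entry (endo_matrix e) v w = (if v \<in> verts \<Gamma> \<and> w \<in> verts \<Gamma> \<and> fst v = fst w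
     then Poly_Mapping.lookup (e (fst v) (Poly_Mapping.single (snd v) 1)) (snd w) else 0)"
  unfolding endo_matrix_def
  by (rule entry_Matrix, rule finite_subset[OF _ finite_G]) (auto split: if_splits)

lemma endo_lin:
  assumes "endo_family free_sc Q (scalar_ext Q V :: ('v, 'a, 'x \<Rightarrow>\<^sub>0 'k::field) lin_rep) e" "i \<in> verts Q"
  shows "lin_on free_sc free_sc {p. Poly_Mapping.keys p \<subseteq> nonzero_pts i} {p. Poly_Mapping.keys p \<subseteq> nonzero_pts i} (e i)"
  using assms unfolding endo_family_def vsp_scalar_ext by blast

lemma lookup_endo:
  fixes e :: "'v \<Rightarrow> ('x \<Rightarrow>\<^sub>0 'k::field) \<Rightarrow> ('x \<Rightarrow>\<^sub>0 'k)"
  assumes e: "endo_family free_sc Q (scalar_ext Q V) e" and i: "i \<in> verts Q"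
    and p: "Poly_Mapping.keys p \<subseteq> nonzero_pts i" and z: "z \<in> nonzero_pts i"
  shows "Poly_Mapping.lookup (e i p) z
    = (\<Sum>y\<in>nonzero_pts i. Poly_Mapping.lookup p y * entry (endo_matrix e) (i, y) (i, z))"
  unfolding lin_on_expand[OF endo_lin[OF e i] finite_nonzero_pts[OF i] p]
  using i z by (intro sum.cong) (auto simp: entry_endo_matrix in_verts)

lemma keys_endo:
  fixes e :: "'v \<Rightarrow> ('x \<Rightarrow>\<^sub>0 'k::field) \<Rightarrow> ('x \<Rightarrow>\<^sub>0 'k)"
  assumes "endo_family free_sc Q (scalar_ext Q V) e" "i \<in> verts Q" "Poly_Mapping.keys p \<subseteq> nonzero_pts i"
  shows "Poly_Mapping.keys (e i p) \<subseteq> nonzero_pts i"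
  using lin_on_mem[OF endo_lin[OF assms(1,2)]] assms(3) by blast

text \<open>
  For vertices \<open>v = (i, x)\<close> over the source and \<open>w = (j, z)\<close> over the target of \<open>\<alpha>\<close>, both entries are
  the coefficient of \<open>z\<close> in the image of \<open>x\<close> under \<open>e\<close> and \<open>\<alpha>\<close>, applied in either order.
  Elsewhere both entries vanish.
\<close>
lemma endo_matrix_commutes:
  fixes e :: "'v \<Rightarrow> ('x \<Rightarrow>\<^sub>0 'k::field) \<Rightarrow> ('x \<Rightarrow>\<^sub>0 'k)"
  assumes e: "endo_family free_sc Q (scalar_ext Q V) e"
  shows "endo_matrix e * arrow_matrix \<alpha> = arrow_matrix \<alpha> * endo_matrix e"
proof (rule matrix_eqI)
  fix v w :: "'v \<times> 'x"
  let ?E = "endo_matrix e"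
  have left: "entry (?E * arrow_matrix \<alpha>) v w = (\<Sum>u\<in>verts \<Gamma>. if (\<alpha>, u, w) \<in> arcs \<Gamma> then entry ?E v u else 0)"
    by (subst entry_mult_supported) (auto simp: entry_endo_matrix entry_arrow split: if_splits intro!: sum.cong)
  note right = entry_arrow_mult[of \<alpha> ?E v w]
  show "entry (?E * arrow_matrix \<alpha>) v w = entry (arrow_matrix \<alpha> * ?E) v w"
  proof (cases "\<alpha> \<in> arcs Q \<and> v \<in> verts \<Gamma> \<and> w \<in> verts \<Gamma> \<and> fst v = tail Q \<alpha> \<and> fst w = head Q \<alpha>")
    case False
    have "entry (?E * arrow_matrix \<alpha>) v w = 0"
      unfolding left using False by (intro sum.neutral) (auto simp: entry_endo_matrix arcs_coeff_quiver)
    moreover have "entry (arrow_matrix \<alpha> * ?E) v w = 0"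
      unfolding right using False by (intro sum.neutral) (auto simp: entry_endo_matrix arcs_coeff_quiver)
    ultimately show ?thesis by simp
  next
    case True
    define i where "i = tail Q \<alpha>"
    define j where "j = head Q \<alpha>"
    obtain x z where v: "v = (i, x)" and w: "w = (j, z)"
      using True unfolding i_def j_def by (metis prod.collapse)
    have \<alpha>: "\<alpha> \<in> arcs Q" and ij: "i \<in> verts Q" "j \<in> verts Q" and x: "x \<in> nonzero_pts i" and z: "z \<in> nonzero_pts j"
      using True wf_Q v w unfolding i_def j_def by (auto simp: in_verts wf_digraph_def)
    let ?s = "Poly_Mapping.single x (1::'k)"
    have s: "Poly_Mapping.keys ?s \<subseteq> nonzero_pts i" using x by simp
    have "entry (?E * arrow_matrix \<alpha>) v w
        = (\<Sum>y\<in>nonzero_pts i. if (\<alpha>, (i, y), w) \<in> arcs \<Gamma> then entry ?E v (i, y) else 0)"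
      unfolding left using ij(1) by (intro sum_fibre) (auto simp: arcs_coeff_quiver i_def)
    also have "\<dots> = (\<Sum>y\<in>nonzero_pts i. if act V \<alpha> y = z \<and> z \<noteq> base V (head Q \<alpha>)
        then Poly_Mapping.lookup (e i ?s) y else 0)"
      using ij x z \<alpha> by (intro sum.cong)
        (auto simp: arcs_coeff_quiver v w in_verts entry_endo_matrix simp flip: i_def j_def)
    also have "\<dots> = Poly_Mapping.lookup (lmap (scalar_ext Q V) \<alpha> (e i ?s)) z"
      by (rule lookup_lmap_scalar_ext[OF finite_nonzero_pts[OF ij(1)] keys_endo[OF e ij(1) s], symmetric])
    also have "\<dots> = Poly_Mapping.lookup (e j (lmap (scalar_ext Q V) \<alpha> ?s)) z"
    proof -
      have "?s \<in> vsp (scalar_ext Q V) i" using s by (simp add: vsp_scalar_ext)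
      then show ?thesis using e \<alpha> unfolding endo_family_def i_def j_def by simp
    qed
    also have "\<dots> = entry (arrow_matrix \<alpha> * ?E) v w"
    proof (cases "act V \<alpha> x = base V j")
      case True
      then have "(\<alpha>, v, u) \<notin> arcs \<Gamma>" for u
        by (auto simp: arcs_coeff_quiver v verts_coeff_quiver simp flip: j_def)
      then show ?thesis
        using True lin_on_zero[OF endo_lin[OF e ij(2)]]
        by (simp add: right lmap_scalar_ext_single flip: j_def)
    next
      case False
      let ?y = "act V \<alpha> x"
      have y: "?y \<in> nonzero_pts j"
        using False rep \<alpha> x by (auto simp: is_f1_rep_def f1_linear_def i_def j_def)
      have "(\<alpha>, v, u) \<in> arcs \<Gamma> \<longleftrightarrow> u = (j, ?y)" for u
        using \<alpha> ij x y by (cases u) (auto simp: arcs_coeff_quiver v in_verts simp flip: i_def j_def)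
      then have "entry (arrow_matrix \<alpha> * ?E) v w = entry ?E (j, ?y) w"
        using finite_G y ij by (simp add: right in_verts)
      then show ?thesis
        using False y z ij by (simp add: lmap_scalar_ext_single entry_endo_matrix w in_verts flip: j_def)
    qed
    finally show ?thesis .
  qed
qed

lemma endo_matrix_in:
  assumes "endo_family free_sc Q (scalar_ext Q V :: ('v, 'a, 'x \<Rightarrow>\<^sub>0 'k::field) lin_rep) e"
  shows "endo_matrix e \<in> graded_endos []"
  using endo_matrix_commutes[OF assms] unfolding graded_endos_def
  by (simp add: entry_endo_matrix)

lemma endo_matrix_idempotent:
  fixes e :: "'v \<Rightarrow> ('x \<Rightarrow>\<^sub>0 'k::field) \<Rightarrow> ('x \<Rightarrow>\<^sub>0 'k)"
  assumes e: "endo_family free_sc Q (scalar_ext Q V) e"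
    and idem: "\<And>i p. i \<in> verts Q \<Longrightarrow> p \<in> vsp (scalar_ext Q V) i \<Longrightarrow> e i (e i p) = e i p"
  shows "endo_matrix e * endo_matrix e = endo_matrix e"
proof (rule matrix_eqI)
  fix v w :: "'v \<times> 'x"
  let ?E = "endo_matrix e"
  have prod: "entry (?E * ?E) v w = (\<Sum>u\<in>verts \<Gamma>. entry ?E v u * entry ?E u w)"
    by (rule entry_mult_supported) (auto simp: entry_endo_matrix split: if_splits)
  show "entry (?E * ?E) v w = entry ?E v w"
  proof (cases "v \<in> verts \<Gamma> \<and> w \<in> verts \<Gamma> \<and> fst v = fst w")
    case False
    then have "entry (?E * ?E) v w = 0"
      unfolding prod by (intro sum.neutral) (auto simp: entry_endo_matrix)
    then show ?thesis using False by (auto simp: entry_endo_matrix)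
  next
    case True
    then obtain i x z where v: "v = (i, x)" and w: "w = (i, z)" by (metis prod.collapse)
    have i: "i \<in> verts Q" and x: "x \<in> nonzero_pts i" and z: "z \<in> nonzero_pts i"
      using True v w by (auto simp: in_verts)
    let ?s = "Poly_Mapping.single x (1::'k)"
    have s: "Poly_Mapping.keys ?s \<subseteq> nonzero_pts i" using x by simp
    have "entry (?E * ?E) v w = (\<Sum>y\<in>nonzero_pts i. entry ?E v (i, y) * entry ?E (i, y) w)"
      unfolding prod using i by (intro sum_fibre) (auto simp: entry_endo_matrix w)
    also have "\<dots> = (\<Sum>y\<in>nonzero_pts i. Poly_Mapping.lookup (e i ?s) y * entry ?E (i, y) (i, z))"
      using i x by (intro sum.cong) (auto simp: entry_endo_matrix v w in_verts)
    also have "\<dots> = Poly_Mapping.lookup (e i (e i ?s)) z"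
      by (rule lookup_endo[OF e i keys_endo[OF e i s] z, symmetric])
    also have "\<dots> = Poly_Mapping.lookup (e i ?s) z"
      using idem[OF i] s by (simp add: vsp_scalar_ext)
    also have "\<dots> = entry ?E v w" using i x z by (simp add: entry_endo_matrix v w in_verts)
    finally show ?thesis .
  qed
qed

lemma endo_of_scalar_matrix:
  fixes e :: "'v \<Rightarrow> ('x \<Rightarrow>\<^sub>0 'k::field) \<Rightarrow> ('x \<Rightarrow>\<^sub>0 'k)"
  assumes e: "endo_family free_sc Q (scalar_ext Q V) e" and c: "endo_matrix e = scalar_matrix c"
    and i: "i \<in> verts Q" and p: "p \<in> vsp (scalar_ext Q V) i"
  shows "e i p = free_sc c p"
proof (rule poly_mapping_eqI)
  fix z
  have p': "Poly_Mapping.keys p \<subseteq> nonzero_pts i" using p by (simp add: vsp_scalar_ext)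
  show "Poly_Mapping.lookup (e i p) z = Poly_Mapping.lookup (free_sc c p) z"
  proof (cases "z \<in> nonzero_pts i")
    case True
    have "Poly_Mapping.lookup (e i p) z
        = (\<Sum>y\<in>nonzero_pts i. Poly_Mapping.lookup p y * entry (scalar_matrix c) (i, y) (i, z))"
      unfolding lookup_endo[OF e i p' True] c ..
    also have "\<dots> = (\<Sum>y\<in>nonzero_pts i. if y = z then c * Poly_Mapping.lookup p z else 0)"
      using i by (intro sum.cong) (auto simp: entry_scalar in_verts)
    finally show ?thesis using True finite_nonzero_pts[OF i] by simp
  next
    case False
    then have "z \<notin> Poly_Mapping.keys (e i p)" "z \<notin> Poly_Mapping.keys p"
      using keys_endo[OF e i p'] p' by blast+
    then show ?thesis by (simp add: in_keys_iff)
  qed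
qed

lemma nice_iff: "nice ds d \<longleftrightarrow> nice_grading Q V ds d"
proof -
  have ends: "tail \<Gamma> (\<alpha>, v, w) = v" "head \<Gamma> (\<alpha>, v, w) = w" for \<alpha> v w
    by (simp_all add: coeff_quiver_def Let_def)
  have "nice_grading Q V ds d \<longleftrightarrow> (\<forall>l v w. (l, v, w) \<in> arcs \<Gamma> \<longrightarrow>
      (\<forall>l' v' w'. (l', v', w') \<in> arcs \<Gamma> \<longrightarrow>
        l = l' \<and> (\<forall>e\<in>set ds. e v = e v') \<and> (\<forall>e\<in>set ds. e w = e w') \<longrightarrow> d v - d w = d v' - d w'))"
    unfolding nice_grading_def Let_def Ball_def split_paired_All ends fst_conv ..
  then show ?thesis unfolding nice_def ball_conj_distrib by metis
qed

end

theorem theorem1p2: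
  fixes Q :: "('v, 'a) pre_digraph"
    and V :: "('v, 'a, 'x) f1_rep"
  assumes "fin_digraph Q"
    and "f1_indecomposable Q V"
    and "finite_nice_length Q V"
  shows "absolutely_indecomposable TYPE('k::field) Q V"
proof -
  have V: "is_f1_rep Q V" "f1_nonzero Q V" using assms(2) by (simp_all add: f1_indecomposable_def)
  interpret coeff_labelled_quiver Q V using assms(1) V(1) by (rule coeff_labelled_quiver.intro)
  obtain ds where nice: "nice_sequence Q V ds"
    and distinguish: "\<And>v w. v \<in> verts \<Gamma> \<Longrightarrow> w \<in> verts \<Gamma> \<Longrightarrow> v \<noteq> w \<Longrightarrow> \<exists>d\<in>set ds. d v \<noteq> d w"
    using assms(3) unfolding finite_nice_length_def by blast
  let ?M = "scalar_ext Q V :: ('v, 'a, 'x \<Rightarrow>\<^sub>0 'k) lin_rep"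
  have "lin_indecomposable free_sc Q ?M"
  proof (rule lin_indecomposableI[OF wf_Q is_lin_rep_scalar_ext[OF wf_Q V(1)] lin_nonzero_scalar_ext[OF V]])
    fix e assume e: "endo_family free_sc Q ?M e"
      and idem: "\<And>i x. i \<in> verts Q \<Longrightarrow> x \<in> vsp ?M i \<Longrightarrow> e i (e i x) = e i x"
    have "endo_matrix e = 0 \<or> endo_matrix e = scalar_matrix 1"
    proof (rule idempotent_endo_trivial)
      show "nice (take i ds) (ds ! i)" if "i < length ds" for i
        using nice that by (simp add: nice_sequence_def nice_iff)
      show "(\<forall>v\<in>verts \<Gamma>. P v) \<or> (\<forall>v\<in>verts \<Gamma>. \<not> P v)"
        if "\<And>l v w. (l, v, w) \<in> arcs \<Gamma> \<Longrightarrow> P v = P w" for P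
        by (rule f1_indecomposable_connected[OF wf_Q assms(2) that])
      show "endo_matrix e * endo_matrix e = endo_matrix e"
        by (rule endo_matrix_idempotent[OF e]) (rule idem)
    qed (fact distinguish endo_matrix_in[OF e])+
    moreover have "(0 :: ('v \<times> 'x, 'k) row_finite_matrix) = scalar_matrix 0"
      by (rule matrix_eqI) (simp add: entry_scalar entry_simps)
    ultimately consider "endo_matrix e = scalar_matrix 0" | "endo_matrix e = scalar_matrix 1" by metis
    then show "(\<forall>i\<in>verts Q. \<forall>x\<in>vsp ?M i. e i x = 0) \<or> (\<forall>i\<in>verts Q. \<forall>x\<in>vsp ?M i. e i x = x)"
    proof cases
      case 1
      then show ?thesis using endo_of_scalar_matrix[OF e 1] by simp
    next
      case 2
      then show ?thesis using endo_of_scalar_matrix[OF e 2] by simp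
    qed
  qed
  then show ?thesis using assms(2) unfolding absolutely_indecomposable_def by blast
qed

end
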